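(* Thompson's group $T$ is not invariably generated.
   Context: $S^1$ is the interval $[0,1]$ with $0$ and $1$ identified. Thompson's group $T$ is the group of piecewise linear orientation-preserving homeomorphisms of $S^1$ which preserve the set of finite dyadic fractions, have finitely many breakpoints, all at finite dyadic fractions, and all slopes integer powers of $2$. A group $G$ is invariably generated if there is a subset $S\subseteq G$ such that $G=\langle s^{g(s)}: s\in S\rangle$ for every choice of $g(s)\in G$, $s\in S$; equivalently, no proper subgroup of $G$ meets every conjugacy class of $G$. *)

theory Defs
  imports Complex_Main "HOL-Algebra.Generated_Groups"
begin

definition dyadic :: "real \<Rightarrow> bool" where
  "dyadic x \<longleftrightarrow> (\<exists>m::int. \<exists>n::nat. x = real_of_int m / 2 ^ n)"

text \<open>S^1 = [0,1] with 0 ~ 1, represented by [0,1) via frac.  An element of T is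
  given through its lift F : R -> R (a continuous, strictly increasing map with
  F(x+1) = F(x) + 1, i.e. an orientation-preserving circle homeomorphism), which is
  piecewise linear with finitely many breakpoints in [0,1], all dyadic, all slopes
  integer powers of 2, and which preserves the dyadic rationals.\<close>
definition thompson_lift :: "(real \<Rightarrow> real) \<Rightarrow> bool" where
  "thompson_lift F \<longleftrightarrow>
     continuous_on UNIV F \<and> strict_mono F \<and> (\<forall>x. F (x + 1) = F x + 1) \<and>
     (\<forall>x. dyadic x \<longleftrightarrow> dyadic (F x)) \<and>
     (\<exists>B. finite B \<and> (\<forall>b\<in>B. dyadic b) \<and>
        (\<forall>x\<in>{0..1} - B. \<exists>k::int. \<exists>e>0. \<forall>y. \<bar>y - x\<bar> < e \<longrightarrow>
              F y = F x + 2 powr (real_of_int k) * (y - x)))"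

definition thompson_T_set :: "(real \<Rightarrow> real) set" where
  "thompson_T_set = {(\<lambda>x. frac (F x)) | F. thompson_lift F}"

definition thompson_T :: "(real \<Rightarrow> real) monoid" where
  "thompson_T = \<lparr>carrier = thompson_T_set, mult = (\<circ>), one = frac\<rparr>"

definition invariably_generated :: "('a, 'b) monoid_scheme \<Rightarrow> bool" where
  "invariably_generated G \<longleftrightarrow>
     (\<exists>S \<subseteq> carrier G. \<forall>g \<in> S \<rightarrow> carrier G.
        generate G ((\<lambda>s. inv\<^bsub>G\<^esub> (g s) \<otimes>\<^bsub>G\<^esub> s \<otimes>\<^bsub>G\<^esub> g s) ` S) = carrier G)"

end

theory Submission
  imports Defs "HOL-Algebra.Group_Action" "HOL-Analysis.Analysis"
begin

text \<open>
  Ping-pong. Suppose that every \<open>s \<in> T\<close> has an interval \<open>I\<close> of the circle with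
  \<open>s\<^sup>k I \<inter> I = {}\<close> whenever \<open>s\<^sup>k \<noteq> 1\<close>. Since \<open>T\<close> is countable, one can choose
  pairwise disjoint intervals \<open>J\<^sub>s \<subseteq> (0, 1/2)\<close>, and an element \<open>h\<^sub>s \<in> T\<close> that maps the
  complement of \<open>J\<^sub>s\<close> into \<open>I\<close>. The nontrivial powers of the conjugate of \<open>s\<close> by \<open>h\<^sub>s\<close>
  then map the complement of \<open>J\<^sub>s\<close> into \<open>J\<^sub>s\<close>, so the orbit of \<open>0\<close> under the group
  generated by these conjugates lies in \<open>{0} \<union> (\<Union>s. J\<^sub>s)\<close>. It misses \<open>1/2\<close>, although
  the rotation by \<open>1/2\<close> belongs to \<open>T\<close>.

  The interval \<open>I\<close> exists as soon as \<open>s\<close> has a periodic point. Let \<open>q\<close> be the minimal period.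
  If \<open>s\<^sup>q = 1\<close>, a short interval will do; otherwise take the interval between a point \<open>c\<close> and
  \<open>s\<^sup>q c \<noteq> c\<close>.

  Periodic points exist by a Denjoy-type argument. Suppose that the lift \<open>F\<close> has none, and let
  \<open>W\<close> be the open invariant set of points with a neighbourhood whose forward images shrink to
  length \<open>0\<close>. It contains every dyadic \<open>y\<close>: the points \<open>F\<^sup>n y\<close> are distinct
  modulo \<open>1\<close>, so their denominators tend to infinity, and for large denominators the slope of
  \<open>F\<close> is exactly the factor by which the denominator decreases. Since \<open>F\<^sup>n 1 - F\<^sup>n 0 = 1\<close>, the
  set \<open>W\<close> is not the whole line, so there is a least \<open>a > 0\<close> outside \<open>W\<close>. The images of
  \<open>[0, a)\<close> are disjoint modulo \<open>1\<close>, hence shrink; as the breakpoints lie in \<open>W\<close>, far along the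
  orbit of \<open>a\<close> the map is affine at the scale of these images, so the intervals on the other side
  of \<open>F\<^sup>n a\<close> shrink too, and \<open>a \<in> W\<close>, which is absurd.
\<close>

section \<open>Lifts of circle homeomorphisms\<close>

lemma frac_eq_frac_iff: "frac x = frac y \<longleftrightarrow> x - y \<in> \<int>"
proof
  assume "frac x = frac y"
  then show "x - y \<in> \<int>" by (rule frac_eqE) simp
next
  assume "x - y \<in> \<int>"
  then show "frac x = frac y" using frac_add_int_right[of "x - y" y] by simp
qed

locale circle_lift =
  fixes F :: "real \<Rightarrow> real"
  assumes continuous: "continuous_on UNIV F"
    and strict_mono: "strict_mono F"
    and add_1: "F (x + 1) = F x + 1"
begin

lemma less_iff [simp]: "F x < F y \<longleftrightarrow> x < y"
  using strict_mono by (rule strict_mono_less)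

lemma le_iff [simp]: "F x \<le> F y \<longleftrightarrow> x \<le> y"
  using strict_mono by (rule strict_mono_less_eq)

lemma eq_iff [simp]: "F x = F y \<longleftrightarrow> x = y"
  using strict_mono by (rule strict_mono_eq)

lemma tendsto_nhds: "(F \<longlongrightarrow> F x) (nhds x)"
  using continuous
  by (simp add: continuous_on_eq_continuous_at isCont_def tendsto_at_iff_tendsto_nhds)

lemma add_int [simp]: "F (x + of_int m) = F x + of_int m"
proof (induction m rule: int_induct[where k = 0])
  case (step1 i)
  then show ?case using add_1[of "x + of_int i"] by (simp add: add.assoc)
next
  case (step2 i)
  then show ?case using add_1[of "x + of_int (i - 1)"] by (simp add: algebra_simps)
qed simp

lemma diff_int [simp]: "F (x - of_int m) = F x - of_int m"
  using add_int[of x "- m"] by simp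

lemma diff_in_Ints_iff [simp]: "F x - F y \<in> \<int> \<longleftrightarrow> x - y \<in> \<int>"
proof
  assume "F x - F y \<in> \<int>"
  then obtain m :: int where "F x - F y = of_int m" by (rule Ints_cases)
  then have "F x = F (y + of_int m)" by simp
  then show "x - y \<in> \<int>" unfolding eq_iff by simp
next
  assume "x - y \<in> \<int>"
  then obtain m :: int where "x - y = of_int m" by (rule Ints_cases)
  then have "x = y + of_int m" by simp
  then show "F x - F y \<in> \<int>" by simp
qed

lemma surj: "surj F"
proof -
  have "\<exists>x. y = F x" for y
  proof -
    define m where "m = \<lfloor>y - F 0\<rfloor>"
    have "F (0 + of_int m) \<le> y" "y \<le> F (0 + of_int (m + 1))"
      unfolding add_int m_def by linarith+
    then have "\<exists>x\<ge>0 + of_int m. x \<le> 0 + of_int (m + 1) \<and> F x = y"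
      by (intro IVT') (auto intro: continuous_on_subset[OF continuous])
    then show ?thesis by blast
  qed
  then show ?thesis by (simp add: surj_def)
qed

end

definition circle_map :: "(real \<Rightarrow> real) \<Rightarrow> real \<Rightarrow> real" where
  "circle_map F = (\<lambda>x. frac (F x))"

lemma (in circle_lift) circle_map_frac: "circle_map F (frac x) = circle_map F x"
  unfolding circle_map_def frac_eq_frac_iff diff_in_Ints_iff by (simp add: frac_def)

lemma (in circle_lift) circle_map_comp: "circle_map F \<circ> circle_map G = circle_map (F \<circ> G)"
  using circle_map_frac by (auto simp: circle_map_def)

lemma circle_lift_surjI:
  assumes "strict_mono F" "surj F" "\<And>x. F (x + 1) = F x + 1"
  shows "circle_lift F"
proof
  show "continuous_on UNIV F"
    using assms(1,2) by (intro continuous_onI_mono) (auto dest: strict_mono_mono monoD)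
qed (use assms in auto)

lemma circle_lift_translation: "circle_lift (\<lambda>x. x + r)"
  by unfold_locales (auto intro!: continuous_intros strict_monoI)

lemma circle_lift_comp:
  assumes "circle_lift F" "circle_lift G"
  shows "circle_lift (F \<circ> G)"
proof -
  interpret F: circle_lift F by fact
  interpret G: circle_lift G by fact
  show ?thesis
  proof
    show "continuous_on UNIV (F \<circ> G)"
      using continuous_on_compose[OF G.continuous] continuous_on_subset[OF F.continuous] by blast
  qed (simp_all add: strict_monoI F.add_1 G.add_1)
qed

lemma (in circle_lift) circle_lift_inverse:
  assumes FG: "\<And>x. F (G x) = x"
  shows "circle_lift G"
proof (rule circle_lift_surjI)
  show "strict_mono G"
    using less_iff[of "G x" "G y" for x y] by (intro strict_monoI) (simp add: FG)
  have "G (F x) = x" for x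
    using eq_iff[of "G (F x)" x] by (simp add: FG)
  then show "surj G" by (rule surjI)
  show "G (x + 1) = G x + 1" for x
    using eq_iff[of "G (x + 1)" "G x + 1"] by (simp add: FG add_1)
qed

context circle_lift
begin

lemma circle_lift_funpow: "circle_lift (F ^^ n)"
proof (induction n)
  case 0
  show ?case using circle_lift_translation[of 0] by (simp add: id_def)
next
  case (Suc n)
  then show ?case using circle_lift_comp[OF circle_lift_axioms] by (simp add: comp_def)
qed

lemmas funpow_less_iff [simp] = circle_lift.less_iff[OF circle_lift_funpow]
  and funpow_le_iff [simp] = circle_lift.le_iff[OF circle_lift_funpow]
  and funpow_add_int [simp] = circle_lift.add_int[OF circle_lift_funpow]
  and funpow_diff_in_Ints_iff [simp] = circle_lift.diff_in_Ints_iff[OF circle_lift_funpow]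
  and funpow_surj = circle_lift.surj[OF circle_lift_funpow]

lemma circle_lift_diff_int: "circle_lift (\<lambda>x. F x - of_int p)"
  using circle_lift_comp[OF circle_lift_translation circle_lift_axioms, of "- of_int p"]
  by (simp add: comp_def)

lemma funpow_diff_int: "((\<lambda>x. F x - of_int p) ^^ n) x = (F ^^ n) x - of_int (int n * p)"
proof (induction n)
  case (Suc n)
  have "((\<lambda>x. F x - of_int p) ^^ Suc n) x = F ((F ^^ n) x - of_int (int n * p)) - of_int p"
    by (simp only: Suc funpow.simps comp_apply)
  also have "\<dots> = (F ^^ Suc n) x - of_int (int (Suc n) * p)"
    unfolding diff_int by (simp add: algebra_simps)
  finally show ?case .
qed simp

end

section \<open>Dyadic rationals\<close>

definition dyadic_grid :: "nat \<Rightarrow> real set" where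
  "dyadic_grid N = range (\<lambda>m::int. of_int m / 2 ^ N)"

lemma dyadic_gridI: "of_int m / 2 ^ N \<in> dyadic_grid N"
  by (simp add: dyadic_grid_def)

lemma dyadic_gridE:
  assumes "x \<in> dyadic_grid N"
  obtains m :: int where "x = of_int m / 2 ^ N"
  using assms unfolding dyadic_grid_def by blast

lemma dyadic_grid_mono:
  assumes "N \<le> M"
  shows "dyadic_grid N \<subseteq> dyadic_grid M"
proof
  fix x assume "x \<in> dyadic_grid N"
  then obtain m :: int where "x = of_int m / 2 ^ N" by (rule dyadic_gridE)
  moreover have "(2::real) ^ M = 2 ^ N * 2 ^ (M - N)" using assms by (simp flip: power_add)
  ultimately have "x = of_int (m * 2 ^ (M - N)) / 2 ^ M" by simp
  then show "x \<in> dyadic_grid M" by (simp only: dyadic_gridI)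
qed

lemma of_int_in_dyadic_grid: "of_int m \<in> dyadic_grid N"
  using dyadic_grid_mono[of 0 N] dyadic_gridI[of m 0] by auto

lemma dyadic_grid_add: "x \<in> dyadic_grid N \<Longrightarrow> y \<in> dyadic_grid N \<Longrightarrow> x + y \<in> dyadic_grid N"
  unfolding dyadic_grid_def by (auto simp flip: add_divide_distrib of_int_add)

lemma dyadic_grid_uminus: "x \<in> dyadic_grid N \<Longrightarrow> - x \<in> dyadic_grid N"
  unfolding dyadic_grid_def by (auto simp: minus_divide_left simp flip: of_int_minus)

lemma dyadic_grid_diff: "x \<in> dyadic_grid N \<Longrightarrow> y \<in> dyadic_grid N \<Longrightarrow> x - y \<in> dyadic_grid N"
  using dyadic_grid_add[OF _ dyadic_grid_uminus] by simp

lemma dyadic_grid_add_int_iff: "x + of_int m \<in> dyadic_grid N \<longleftrightarrow> x \<in> dyadic_grid N"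
  using dyadic_grid_add[OF _ of_int_in_dyadic_grid] dyadic_grid_diff[OF _ of_int_in_dyadic_grid]
  by (metis add_diff_cancel_right')

lemma dyadic_grid_frac_iff: "frac x \<in> dyadic_grid N \<longleftrightarrow> x \<in> dyadic_grid N"
  using dyadic_grid_add_int_iff[of "frac x" "\<lfloor>x\<rfloor>"] by (simp add: frac_def)

lemma dyadic_iff_grid: "dyadic x \<longleftrightarrow> (\<exists>N. x \<in> dyadic_grid N)"
  by (auto simp: dyadic_def dyadic_grid_def)

lemma dyadic_add:
  assumes "dyadic x" "dyadic y"
  shows "dyadic (x + y)"
proof -
  obtain N M where "x \<in> dyadic_grid N" "y \<in> dyadic_grid M"
    using assms by (auto simp: dyadic_iff_grid)
  then have "x \<in> dyadic_grid (max N M)" "y \<in> dyadic_grid (max N M)"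
    using dyadic_grid_mono[of N "max N M"] dyadic_grid_mono[of M "max N M"] by auto
  then show ?thesis unfolding dyadic_iff_grid by (blast intro: dyadic_grid_add)
qed

lemma dyadic_uminus: "dyadic x \<Longrightarrow> dyadic (- x)"
  unfolding dyadic_iff_grid by (blast intro: dyadic_grid_uminus)

lemma dyadic_diff: "dyadic x \<Longrightarrow> dyadic y \<Longrightarrow> dyadic (x - y)"
  using dyadic_add[OF _ dyadic_uminus] by simp

lemma dyadic_of_int: "dyadic (of_int m)"
  using of_int_in_dyadic_grid by (auto simp: dyadic_iff_grid)

lemma dyadic_add_iff: "dyadic y \<Longrightarrow> dyadic (x + y) \<longleftrightarrow> dyadic x"
  using dyadic_add dyadic_diff[of "x + y" y] by auto

lemma dyadic_frac_iff: "dyadic (frac x) \<longleftrightarrow> dyadic x"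
  using dyadic_add_iff[OF dyadic_of_int, of "frac x" "\<lfloor>x\<rfloor>"] by (simp add: frac_def)

lemma dyadic_divide_power2: "dyadic (of_int m / 2 ^ n)"
  by (auto simp: dyadic_def)

lemma dyadic_powr_mult:
  fixes k :: int
  assumes "dyadic x"
  shows "dyadic (2 powr k * x)"
proof -
  obtain m :: int and n where x_eq: "x = of_int m / 2 ^ n" using assms by (auto simp: dyadic_def)
  show ?thesis
  proof (cases "k \<ge> 0")
    case True
    then have "2 powr k * x = of_int (2 ^ nat k * m) / 2 ^ n" by (simp add: x_eq powr_real_of_int)
    then show ?thesis by (simp only: dyadic_divide_power2)
  next
    case False
    then have "2 powr k * x = of_int m / 2 ^ (nat (- k) + n)"
      by (simp add: x_eq powr_real_of_int power_add field_simps)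
    then show ?thesis by (simp only: dyadic_divide_power2)
  qed
qed

lemma finite_dyadic_subset_grid:
  assumes "finite B" "B \<subseteq> Collect dyadic"
  obtains N where "B \<subseteq> dyadic_grid N"
proof -
  have "\<forall>b\<in>B. \<forall>\<^sub>F N in sequentially. b \<in> dyadic_grid N"
  proof
    fix b assume "b \<in> B"
    then obtain M where "b \<in> dyadic_grid M" using assms(2) dyadic_iff_grid by blast
    then show "\<forall>\<^sub>F N in sequentially. b \<in> dyadic_grid N"
      using dyadic_grid_mono unfolding eventually_sequentially by blast
  qed
  then have "\<forall>\<^sub>F N in sequentially. \<forall>b\<in>B. b \<in> dyadic_grid N"
    using assms(1) by (simp add: eventually_ball_finite_distrib)
  then obtain N where "\<forall>b\<in>B. b \<in> dyadic_grid N"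
    using eventually_happens'[OF sequentially_bot] by blast
  then show ?thesis using that by blast
qed

lemma finite_dyadic_grid_Icc: "finite (dyadic_grid N \<inter> {a..b})"
proof (rule finite_subset)
  show "dyadic_grid N \<inter> {a..b} \<subseteq> (\<lambda>m::int. of_int m / 2 ^ N) ` {\<lceil>a * 2 ^ N\<rceil>..\<lfloor>b * 2 ^ N\<rfloor>}"
    by (auto simp: dyadic_grid_def ceiling_le_iff le_floor_iff field_simps)
qed simp

lemma dyadic_grid_meets_Ico:
  assumes "1 / 2 ^ N \<le> v - u"
  obtains g where "g \<in> dyadic_grid N" "u \<le> g" "g < v"
proof -
  define m where "m = \<lceil>u * 2 ^ N\<rceil>"
  have "u * 2 ^ N \<le> of_int m" "of_int m < u * 2 ^ N + 1" unfolding m_def by linarith+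
  then have "u \<le> of_int m / 2 ^ N" "of_int m / 2 ^ N < u + 1 / 2 ^ N" by (simp_all add: field_simps)
  with assms show ?thesis using that[OF dyadic_gridI] by simp
qed

lemma inverse_power2_less:
  assumes "0 < (e::real)"
  obtains N where "1 / 2 ^ N < e"
  using real_arch_pow_inv[of e "1 / 2"] assms by (auto simp: power_divide)

lemma dyadic_dense:
  assumes "u < v"
  obtains r where "dyadic r" "u < r" "r < v"
proof -
  have "0 < (v - u) / 2" using assms by simp
  then obtain N where "1 / 2 ^ N < (v - u) / 2" by (rule inverse_power2_less)
  then obtain r where "r \<in> dyadic_grid N" "(u + v) / 2 \<le> r" "r < v"
    using dyadic_grid_meets_Ico[of N v "(u + v) / 2"] by (auto simp: field_simps)
  then show ?thesis using that[of r] assms by (auto simp: dyadic_iff_grid)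
qed

section \<open>Piecewise linear lifts\<close>

definition pow2_affine_at :: "(real \<Rightarrow> real) \<Rightarrow> real \<Rightarrow> bool" where
  "pow2_affine_at F x \<longleftrightarrow> (\<exists>k::int. \<forall>\<^sub>F y in nhds x. F y = F x + 2 powr k * (y - x))"

definition breakpoints :: "(real \<Rightarrow> real) \<Rightarrow> real set" where
  "breakpoints F = {x. \<not> pow2_affine_at F x}"

lemma pow2_affine_at_comp:
  assumes "pow2_affine_at F (G x)" "pow2_affine_at G x" "(G \<longlongrightarrow> G x) (nhds x)"
  shows "pow2_affine_at (F \<circ> G) x"
proof -
  obtain k l :: int where "\<forall>\<^sub>F y in nhds (G x). F y = F (G x) + 2 powr k * (y - G x)"
    and affine_G: "\<forall>\<^sub>F y in nhds x. G y = G x + 2 powr l * (y - x)"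
    using assms(1,2) by (auto simp: pow2_affine_at_def)
  from this(1) assms(3) have "\<forall>\<^sub>F y in nhds x. F (G y) = F (G x) + 2 powr k * (G y - G x)"
    by (rule eventually_compose_filterlim)
  with affine_G have "\<forall>\<^sub>F y in nhds x. (F \<circ> G) y = (F \<circ> G) x + 2 powr (k + l) * (y - x)"
    by eventually_elim (simp add: powr_add)
  then show ?thesis unfolding pow2_affine_at_def by (metis of_int_add)
qed

lemma pow2_affine_at_inverse:
  assumes "pow2_affine_at F (G x)" "\<And>y. F (G y) = y" "(G \<longlongrightarrow> G x) (nhds x)"
  shows "pow2_affine_at G x"
proof -
  obtain k :: int where "\<forall>\<^sub>F y in nhds (G x). F y = F (G x) + 2 powr k * (y - G x)"
    using assms(1) by (auto simp: pow2_affine_at_def)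
  then have "\<forall>\<^sub>F y in nhds x. F (G y) = F (G x) + 2 powr k * (G y - G x)"
    using assms(3) by (rule eventually_compose_filterlim)
  then have "\<forall>\<^sub>F y in nhds x. G y = G x + 2 powr (- k) * (y - x)"
  proof eventually_elim
    case (elim y)
    then have "y - x = 2 powr k * (G y - G x)" unfolding assms(2) by linarith
    then have "2 powr (- k) * (y - x) = G y - G x" by (simp add: powr_minus)
    then show ?case by simp
  qed
  then show ?thesis unfolding pow2_affine_at_def by (metis of_int_minus)
qed

lemma pow2_affine_atI:
  fixes k :: int
  assumes "a < x" "x < b" "\<And>y. a < y \<Longrightarrow> y < b \<Longrightarrow> F y = 2 powr k * y + c"
  shows "pow2_affine_at F x"
proof -
  have "\<forall>\<^sub>F y in nhds x. y \<in> {a<..<b}"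
    using assms(1,2) by (intro eventually_nhds_in_open) auto
  then have "\<forall>\<^sub>F y in nhds x. F y = F x + 2 powr k * (y - x)"
    by eventually_elim (use assms in \<open>simp add: algebra_simps\<close>)
  then show ?thesis by (auto simp: pow2_affine_at_def)
qed

lemma pow2_affine_at_translation: "pow2_affine_at (\<lambda>x. x + r) x"
  by (rule pow2_affine_atI[of "x - 1" x "x + 1" _ 0 r]) auto

lemma pow2_affine_at_DERIV:
  assumes "pow2_affine_at F x"
  obtains k :: int where "\<forall>\<^sub>F y in nhds x. DERIV F y :> 2 powr k"
proof -
  obtain k :: int where "\<forall>\<^sub>F y in nhds x. F y = F x + 2 powr k * (y - x)"
    using assms unfolding pow2_affine_at_def ..
  then have "\<forall>\<^sub>F y in nhds x. \<forall>\<^sub>F z in nhds y. F z = F x + 2 powr k * (z - x)"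
    by (simp only: eventually_eventually)
  then have "\<forall>\<^sub>F y in nhds x. DERIV F y :> 2 powr k"
  proof eventually_elim
    case (elim y)
    have "DERIV (\<lambda>z. F x + 2 powr k * (z - x)) y :> 2 powr k"
      by (auto intro!: derivative_eq_intros)
    then show ?case using DERIV_cong_ev[OF refl elim refl] by simp
  qed
  then show ?thesis by (rule that)
qed

lemma affine_if_DERIV_const:
  fixes F :: "real \<Rightarrow> real"
  assumes "a < b" "continuous_on {a..b} F"
    and deriv: "\<And>y. a < y \<Longrightarrow> y < b \<Longrightarrow> DERIV F y :> s"
    and "x \<in> {a..b}"
  shows "F x = F a + s * (x - a)"
proof -
  have "F x - s * (x - a) = F a - s * (a - a)"
  proof (rule DERIV_isconst2[OF \<open>a < b\<close>])
    show "continuous_on {a..b} (\<lambda>x. F x - s * (x - a))" by (intro continuous_intros assms(2))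
    show "DERIV (\<lambda>x. F x - s * (x - a)) y :> 0" if "a < y" "y < b" for y
      using deriv[OF that] by (auto intro!: derivative_eq_intros)
  qed (use assms(4) in auto)
  then show ?thesis by simp
qed

lemma pow2_affine_on_Icc:
  assumes "a < b" and cont: "continuous_on {a..b} F" and "{a<..<b} \<inter> breakpoints F = {}"
  obtains k :: int where "\<And>x. x \<in> {a..b} \<Longrightarrow> F x = F a + 2 powr k * (x - a)"
proof -
  have affine_at: "pow2_affine_at F x" if "x \<in> {a<..<b}" for x
    using assms(3) that by (auto simp: breakpoints_def)
  define s where "s = deriv F ((a + b) / 2)"
  have mid: "(a + b) / 2 \<in> {a<..<b}" using \<open>a < b\<close> by simp
  have "deriv F x = s" if "x \<in> {a<..<b}" for x
    unfolding s_def
  proof (rule connected_local_const[OF connected_Ioo that mid], rule ballI)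
    fix u assume "u \<in> {a<..<b}"
    then obtain k :: int where DERIV_u: "\<forall>\<^sub>F v in nhds u. DERIV F v :> 2 powr k"
      using affine_at pow2_affine_at_DERIV by blast
    then have "deriv F u = 2 powr k" by (auto dest: eventually_nhds_x_imp_x intro: DERIV_imp_deriv)
    moreover have "\<forall>\<^sub>F v in nhds u. deriv F v = 2 powr k"
      using DERIV_u by eventually_elim (rule DERIV_imp_deriv)
    ultimately show "\<forall>\<^sub>F v in at u within {a<..<b}. deriv F u = deriv F v"
      by (simp add: eventually_at_filter eventually_mono)
  qed
  moreover have DERIV: "\<exists>k::int. DERIV F x :> 2 powr k" if "x \<in> {a<..<b}" for x
    using affine_at[OF that] pow2_affine_at_DERIV eventually_nhds_x_imp_x by metis
  ultimately have "DERIV F x :> s" if "a < x" "x < b" for x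
    using that by (metis DERIV_imp_deriv greaterThanLessThan_iff)
  then have "F x = F a + s * (x - a)" if "x \<in> {a..b}" for x
    using affine_if_DERIV_const[OF \<open>a < b\<close> cont _ that] by blast
  moreover obtain k :: int where "s = 2 powr k"
    using DERIV[OF mid] unfolding s_def by (metis DERIV_imp_deriv)
  ultimately show ?thesis using that by blast
qed

lemma (in circle_lift) pow2_affine_at_add_int:
  assumes "pow2_affine_at F x"
  shows "pow2_affine_at F (x + of_int m)"
proof -
  obtain k :: int and d where "d > 0"
    and affine: "\<And>y. \<bar>y - x\<bar> < d \<Longrightarrow> F y = F x + 2 powr k * (y - x)"
    using assms by (auto simp: pow2_affine_at_def eventually_nhds_metric dist_real_def)
  have "F y = F (x + of_int m) + 2 powr k * (y - (x + of_int m))"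
    if "\<bar>y - (x + of_int m)\<bar> < d" for y
    using affine[of "y - of_int m"] that by (simp add: algebra_simps)
  with \<open>d > 0\<close> show ?thesis
    unfolding pow2_affine_at_def eventually_nhds_metric dist_real_def by blast
qed

lemma (in circle_lift) breakpoints_add_int_iff: "x + of_int m \<in> breakpoints F \<longleftrightarrow> x \<in> breakpoints F"
  using pow2_affine_at_add_int[of x m] pow2_affine_at_add_int[of "x + of_int m" "- m"]
  by (auto simp: breakpoints_def)

lemma (in circle_lift) breakpoints_frac_iff: "frac x \<in> breakpoints F \<longleftrightarrow> x \<in> breakpoints F"
  using breakpoints_add_int_iff[of "frac x" "\<lfloor>x\<rfloor>"] by (simp add: frac_def)

lemma (in circle_lift) finite_breakpoints_Icc:
  assumes "finite (breakpoints F \<inter> {0..1})"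
  shows "finite (breakpoints F \<inter> {a..b})"
proof (rule finite_subset)
  let ?B = "breakpoints F \<inter> {0..1}"
  show "breakpoints F \<inter> {a..b} \<subseteq> (\<Union>m\<in>{\<lfloor>a\<rfloor>..\<lfloor>b\<rfloor>}. (\<lambda>x. x + of_int m) ` ?B)"
  proof
    fix x assume "x \<in> breakpoints F \<inter> {a..b}"
    then have "frac x \<in> ?B" "\<lfloor>x\<rfloor> \<in> {\<lfloor>a\<rfloor>..\<lfloor>b\<rfloor>}"
      by (auto simp: floor_mono breakpoints_frac_iff less_imp_le[OF frac_lt_1])
    moreover have "x = frac x + of_int \<lfloor>x\<rfloor>" by (simp add: frac_def)
    ultimately show "x \<in> (\<Union>m\<in>{\<lfloor>a\<rfloor>..\<lfloor>b\<rfloor>}. (\<lambda>x. x + of_int m) ` ?B)" by blast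
  qed
qed (use assms in simp)

locale thompson_circle_lift = circle_lift +
  assumes dyadic_iff: "dyadic (F x) \<longleftrightarrow> dyadic x"
    and dyadic_breakpoints: "breakpoints F \<subseteq> Collect dyadic"
    and finite_breakpoints: "finite (breakpoints F \<inter> {a..b})"

lemma thompson_lift_iff: "thompson_lift F \<longleftrightarrow> thompson_circle_lift F"
proof -
  have cover_iff: "thompson_lift F \<longleftrightarrow> circle_lift F \<and> (\<forall>x. dyadic (F x) \<longleftrightarrow> dyadic x) \<and>
     (\<exists>B. finite B \<and> (\<forall>b\<in>B. dyadic b) \<and> breakpoints F \<inter> {0..1} \<subseteq> B)"
    unfolding thompson_lift_def circle_lift_def breakpoints_def pow2_affine_at_def
      eventually_nhds_metric dist_real_def
    by (simp only: subset_iff) blast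
  show ?thesis
  proof
    assume "thompson_circle_lift F"
    then interpret thompson_circle_lift F .
    have "\<exists>B. finite B \<and> (\<forall>b\<in>B. dyadic b) \<and> breakpoints F \<inter> {0..1} \<subseteq> B"
      using finite_breakpoints[of 0 1] dyadic_breakpoints
      by (intro exI[of _ "breakpoints F \<inter> {0..1}"]) auto
    then show "thompson_lift F" using cover_iff circle_lift_axioms dyadic_iff by blast
  next
    assume F: "thompson_lift F"
    then interpret circle_lift F using cover_iff by blast
    obtain B where cover: "finite B" "\<forall>b\<in>B. dyadic b" "breakpoints F \<inter> {0..1} \<subseteq> B"
      using F cover_iff by blast
    show "thompson_circle_lift F"
    proof
      show "dyadic (F x) \<longleftrightarrow> dyadic x" for x using F cover_iff by blast
      show "breakpoints F \<subseteq> Collect dyadic"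
      proof
        fix x assume "x \<in> breakpoints F"
        then have "frac x \<in> B"
          using cover(3) by (auto simp: breakpoints_frac_iff less_imp_le[OF frac_lt_1])
        then have "dyadic (frac x)" using cover(2) by blast
        then show "x \<in> Collect dyadic" by (simp add: dyadic_frac_iff)
      qed
      show "finite (breakpoints F \<inter> {a..b})" for a b
        by (rule finite_breakpoints_Icc[OF finite_subset[OF cover(3,1)]])
    qed
  qed
qed

lemma thompson_T_set_eq: "thompson_T_set = circle_map ` Collect thompson_circle_lift"
  unfolding thompson_T_set_def circle_map_def thompson_lift_iff by blast

lemma thompson_circle_lift_translation:
  assumes "dyadic r"
  shows "thompson_circle_lift (\<lambda>x. x + r)"
proof -
  interpret circle_lift "\<lambda>x. x + r" by (rule circle_lift_translation)
  have "breakpoints (\<lambda>x. x + r) = {}" by (simp add: breakpoints_def pow2_affine_at_translation)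
  then show ?thesis by unfold_locales (simp_all add: dyadic_add_iff assms)
qed

lemma thompson_circle_lift_comp:
  assumes "thompson_circle_lift F" "thompson_circle_lift G"
  shows "thompson_circle_lift (F \<circ> G)"
proof -
  interpret F: thompson_circle_lift F by fact
  interpret G: thompson_circle_lift G by fact
  interpret circle_lift "F \<circ> G"
    by (rule circle_lift_comp[OF F.circle_lift_axioms G.circle_lift_axioms])
  have breakpoints_comp: "breakpoints (F \<circ> G) \<subseteq> breakpoints G \<union> G -` breakpoints F"
    using pow2_affine_at_comp[OF _ _ G.tendsto_nhds] by (auto simp: breakpoints_def)
  show ?thesis
  proof
    show "breakpoints (F \<circ> G) \<subseteq> Collect dyadic"
      using breakpoints_comp F.dyadic_breakpoints G.dyadic_breakpoints G.dyadic_iff by fastforce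
    show "finite (breakpoints (F \<circ> G) \<inter> {a..b})" for a b
    proof (rule finite_subset)
      show "breakpoints (F \<circ> G) \<inter> {a..b}
          \<subseteq> (breakpoints G \<inter> {a..b}) \<union> G -` (breakpoints F \<inter> {G a..G b})"
        using breakpoints_comp by auto
      have "inj G" by (rule strict_mono_imp_inj_on[OF G.strict_mono])
      then show "finite ((breakpoints G \<inter> {a..b}) \<union> G -` (breakpoints F \<inter> {G a..G b}))"
        by (intro finite_UnI finite_vimageI F.finite_breakpoints G.finite_breakpoints)
    qed
  qed (simp add: F.dyadic_iff G.dyadic_iff)
qed

context thompson_circle_lift
begin

lemma thompson_circle_lift_funpow: "thompson_circle_lift (F ^^ n)"
proof (induction n)
  case 0
  show ?case
    using thompson_circle_lift_translation[OF dyadic_of_int, of 0] by (simp add: id_def)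
next
  case (Suc n)
  then show ?case
    using thompson_circle_lift_comp[OF thompson_circle_lift_axioms] by (simp add: comp_def)
qed

lemma thompson_circle_lift_inverse:
  assumes FG: "\<And>x. F (G x) = x"
  shows "thompson_circle_lift G"
proof -
  interpret G: circle_lift G by (rule circle_lift_inverse[OF FG])
  have breakpoints_inverse: "breakpoints G \<subseteq> G -` breakpoints F"
    using pow2_affine_at_inverse[OF _ FG G.tendsto_nhds] by (auto simp: breakpoints_def)
  show ?thesis
  proof
    show dyadic_G: "dyadic (G x) \<longleftrightarrow> dyadic x" for x using dyadic_iff[of "G x"] by (simp add: FG)
    show "breakpoints G \<subseteq> Collect dyadic"
      using breakpoints_inverse dyadic_breakpoints dyadic_G by auto
    show "finite (breakpoints G \<inter> {a..b})" for a b
    proof (rule finite_subset)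
      show "breakpoints G \<inter> {a..b} \<subseteq> G -` (breakpoints F \<inter> {G a..G b})"
        using breakpoints_inverse by auto
      show "finite (G -` (breakpoints F \<inter> {G a..G b}))"
        by (intro finite_vimageI finite_breakpoints strict_mono_imp_inj_on[OF G.strict_mono])
    qed
  qed
qed

lemma breakpoints_subset_grid: "\<exists>N. breakpoints F \<subseteq> dyadic_grid N"
proof -
  have "breakpoints F \<inter> {0..1} \<subseteq> Collect dyadic" using dyadic_breakpoints by blast
  with finite_breakpoints obtain N where unit_breakpoints: "breakpoints F \<inter> {0..1} \<subseteq> dyadic_grid N"
    by (rule finite_dyadic_subset_grid)
  have "breakpoints F \<subseteq> dyadic_grid N"
  proof
    fix x assume "x \<in> breakpoints F"
    then have "frac x \<in> breakpoints F \<inter> {0..1}"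
      by (simp add: breakpoints_frac_iff less_imp_le[OF frac_lt_1])
    with unit_breakpoints have "frac x \<in> dyadic_grid N" ..
    then show "x \<in> dyadic_grid N" unfolding dyadic_grid_frac_iff .
  qed
  then show ?thesis ..
qed

end

definition dyadic_cell :: "nat \<Rightarrow> int \<Rightarrow> real set" where
  "dyadic_cell N i = {of_int i / 2 ^ N..of_int (i + 1) / 2 ^ N}"

lemma dyadic_cell_interior:
  "{of_int i / 2 ^ N<..<of_int (i + 1) / 2 ^ N} \<inter> dyadic_grid N = {}"
proof -
  have False if "of_int i / 2 ^ N < real_of_int m / 2 ^ N"
    "real_of_int m / 2 ^ N < of_int (i + 1) / 2 ^ N" for m
  proof -
    have "i < m" "m < i + 1"
      using that unfolding divide_less_cancel of_int_less_iff by (auto dest: less_imp_le)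
    then show False by simp
  qed
  then show ?thesis by (auto simp: dyadic_grid_def)
qed

lemma frac_in_dyadic_cell:
  obtains i where "i \<in> {0..<2 ^ N}" "frac x \<in> dyadic_cell N i"
proof
  have "frac x * 2 ^ N < 1 * 2 ^ N" by (intro mult_strict_right_mono frac_lt_1) simp
  then show "\<lfloor>frac x * 2 ^ N\<rfloor> \<in> {0..<2 ^ N}" by (simp add: floor_less_iff)
  show "frac x \<in> dyadic_cell N \<lfloor>frac x * 2 ^ N\<rfloor>"
    by (simp add: dyadic_cell_def pos_divide_le_eq pos_le_divide_eq)
qed

lemma (in circle_lift) affine_on_cell:
  assumes "breakpoints F \<subseteq> dyadic_grid N"
  obtains k :: int where
    "\<And>x. x \<in> dyadic_cell N i \<Longrightarrow> F x = F (of_int i / 2 ^ N) + 2 powr k * (x - of_int i / 2 ^ N)"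
proof -
  have "real_of_int i / 2 ^ N < of_int (i + 1) / 2 ^ N" by (simp add: divide_strict_right_mono)
  moreover have "continuous_on (dyadic_cell N i) F"
    using continuous by (rule continuous_on_subset) simp
  moreover have "{of_int i / 2 ^ N<..<of_int (i + 1) / 2 ^ N} \<inter> breakpoints F = {}"
    using dyadic_cell_interior[of i N] assms by blast
  ultimately show ?thesis
    using that unfolding dyadic_cell_def by (rule pow2_affine_on_Icc)
qed

lemma circle_lift_eqI_grid:
  assumes F: "circle_lift F" "breakpoints F \<subseteq> dyadic_grid N"
    and G: "circle_lift G" "breakpoints G \<subseteq> dyadic_grid N"
    and agree: "\<And>x. x \<in> dyadic_grid N \<inter> {0..1} \<Longrightarrow> F x = G x"
  shows "F = G"
proof
  fix x
  obtain i where cell: "i \<in> {0..<2 ^ N}" "frac x \<in> dyadic_cell N i"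
    by (rule frac_in_dyadic_cell)
  define a b where "a = real_of_int i / 2 ^ N" and "b = real_of_int (i + 1) / 2 ^ N"
  have "a < b" by (simp add: a_def b_def divide_strict_right_mono)
  have "real_of_int (i + 1) \<le> of_int (2 ^ N)" using cell(1) by (simp only: of_int_le_iff) simp
  then have "a \<in> dyadic_grid N \<inter> {0..1}" "b \<in> dyadic_grid N \<inter> {0..1}"
    using cell(1) dyadic_gridI[of i N] dyadic_gridI[of "i + 1" N] by (simp_all add: a_def b_def)
  then have ends: "F a = G a" "F b = G b" by (simp_all only: agree)
  obtain k :: int where affine_F: "\<And>x. x \<in> dyadic_cell N i \<Longrightarrow> F x = F a + 2 powr k * (x - a)"
    using circle_lift.affine_on_cell[OF F, of i] unfolding a_def by blast
  obtain l :: int where affine_G: "\<And>x. x \<in> dyadic_cell N i \<Longrightarrow> G x = G a + 2 powr l * (x - a)"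
    using circle_lift.affine_on_cell[OF G, of i] unfolding a_def by blast
  have "b \<in> dyadic_cell N i" using \<open>a < b\<close> by (simp add: dyadic_cell_def a_def b_def)
  then have "F a + 2 powr k * (b - a) = F a + 2 powr l * (b - a)"
    using affine_F affine_G ends by metis
  then have "F (frac x) = G (frac x)"
    using \<open>a < b\<close> ends affine_F[OF cell(2)] affine_G[OF cell(2)] by simp
  then show "F x = G x"
    using circle_lift.diff_int[OF F(1), of x "\<lfloor>x\<rfloor>"] circle_lift.diff_int[OF G(1), of x "\<lfloor>x\<rfloor>"]
    by (simp add: frac_def)
qed

lemma countable_dyadic: "countable (Collect dyadic)"
proof -
  have "Collect dyadic = (\<Union>N. dyadic_grid N)" by (auto simp: dyadic_iff_grid)
  then show ?thesis by (simp add: dyadic_grid_def)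
qed

lemma countable_thompson_T_set: "countable thompson_T_set"
proof -
  define L where "L N = {F. thompson_circle_lift F \<and> breakpoints F \<subseteq> dyadic_grid N}" for N
  have "countable (L N)" for N
  proof (rule countable_image_inj_on)
    let ?P = "dyadic_grid N \<inter> {0..1}"
    show "countable ((\<lambda>F. restrict F ?P) ` L N)"
    proof (rule countable_subset)
      have "dyadic x" if "x \<in> ?P" for x using that by (auto simp: dyadic_iff_grid)
      then show "(\<lambda>F. restrict F ?P) ` L N \<subseteq> ?P \<rightarrow>\<^sub>E Collect dyadic"
        by (auto simp: L_def thompson_circle_lift.dyadic_iff image_subset_iff restrict_PiE_iff
            simp del: restrict_apply)
      show "countable (?P \<rightarrow>\<^sub>E Collect dyadic)"
        by (intro countable_PiE finite_dyadic_grid_Icc countable_dyadic)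
    qed
    show "inj_on (\<lambda>F. restrict F ?P) (L N)"
    proof (rule inj_onI)
      fix F G assume FG: "F \<in> L N" "G \<in> L N" and eq: "restrict F ?P = restrict G ?P"
      have "F x = G x" if "x \<in> ?P" for x using fun_cong[OF eq, of x] that by simp
      with FG show "F = G"
        unfolding L_def by (auto intro: circle_lift_eqI_grid thompson_circle_lift.axioms(1))
    qed
  qed
  moreover have "Collect thompson_circle_lift = (\<Union>N. L N)"
    using thompson_circle_lift.breakpoints_subset_grid by (auto simp: L_def)
  ultimately show ?thesis unfolding thompson_T_set_eq by simp
qed

section \<open>The mesh of a dyadic rational\<close>

definition mesh :: "real \<Rightarrow> real" where
  "mesh x = 1 / 2 ^ (LEAST n. x \<in> dyadic_grid n)"

lemma mesh_pos: "0 < mesh x"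
  by (simp add: mesh_def)

lemma mesh_diff_int: "mesh (x - of_int m) = mesh x"
  using dyadic_grid_add_int_iff[of x "- m"] by (simp add: mesh_def)

lemma mesh_odd:
  assumes "odd j"
  shows "mesh (of_int j / 2 ^ d) = 1 / 2 ^ d"
proof -
  have "d \<le> n" if grid: "of_int j / 2 ^ d \<in> dyadic_grid n" for n
  proof (rule ccontr)
    assume "\<not> d \<le> n"
    then have split_power: "(2::real) ^ d = 2 ^ n * 2 ^ (d - n)" by (simp flip: power_add)
    obtain m :: int where "real_of_int j / 2 ^ d = of_int m / 2 ^ n"
      using grid by (rule dyadic_gridE)
    then have "real_of_int j = of_int (m * 2 ^ (d - n))" by (simp add: split_power field_simps)
    then have "j = m * 2 ^ (d - n)" by (simp only: of_int_eq_iff)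
    with assms \<open>\<not> d \<le> n\<close> show False by simp
  qed
  then have "(LEAST n. of_int j / 2 ^ d \<in> dyadic_grid n) = d"
    by (intro Least_equality dyadic_gridI) blast
  then show ?thesis by (simp add: mesh_def)
qed

lemma dyadic_odd_numerator:
  assumes "dyadic x" "x \<notin> dyadic_grid N"
  obtains j :: int and d where "odd j" "N < d" "x = of_int j / 2 ^ d"
proof -
  define d where "d = (LEAST d. x \<in> dyadic_grid d)"
  have in_grid: "x \<in> dyadic_grid d"
    using assms(1) unfolding d_def dyadic_iff_grid by (rule LeastI_ex)
  then have "N < d" using assms(2) dyadic_grid_mono[of d N] by force
  obtain j :: int where x_eq: "x = of_int j / 2 ^ d" using in_grid by (rule dyadic_gridE)
  have "odd j"
  proof
    assume "even j"
    then obtain i where "j = 2 * i" by blast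
    then have "x = of_int i / 2 ^ (d - 1)" using x_eq \<open>N < d\<close> by (cases d) auto
    then have "x \<in> dyadic_grid (d - 1)" by (simp only: dyadic_gridI)
    then have "d \<le> d - 1" unfolding d_def by (rule Least_le)
    with \<open>N < d\<close> show False by simp
  qed
  with \<open>N < d\<close> x_eq show ?thesis using that by blast
qed

lemma mesh_less:
  assumes "dyadic x" "x \<notin> dyadic_grid N"
  shows "mesh x < 1 / 2 ^ N"
  using assms by (rule dyadic_odd_numerator) (simp add: mesh_odd divide_strict_left_mono)

lemma mesh_le_dist:
  assumes "dyadic x" "x \<notin> dyadic_grid N" "g \<in> dyadic_grid N"
  shows "mesh x \<le> \<bar>x - g\<bar>"
proof -
  obtain j :: int and d where x_odd: "odd j" "N < d" "x = of_int j / 2 ^ d"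
    using assms(1,2) by (rule dyadic_odd_numerator)
  have "g \<in> dyadic_grid d" using assms(3) dyadic_grid_mono[of N d] x_odd(2) by auto
  then obtain m :: int where g_eq: "g = of_int m / 2 ^ d" by (rule dyadic_gridE)
  have "j \<noteq> m" using assms(2,3) x_odd(3) g_eq by blast
  then have "1 \<le> \<bar>j - m\<bar>" by simp
  then have "1 \<le> real_of_int \<bar>j - m\<bar>" by (simp only: of_int_1_le_iff)
  then have "1 / 2 ^ d \<le> real_of_int \<bar>j - m\<bar> / 2 ^ d" by (intro divide_right_mono) simp_all
  then show ?thesis
    unfolding x_odd(3) g_eq mesh_odd[OF x_odd(1)] by (simp flip: diff_divide_distrib)
qed

lemma eventually_mesh_affine:
  fixes k :: int
  assumes "dyadic c"
  shows "\<forall>\<^sub>F N in sequentially. \<forall>x. dyadic x \<longrightarrow> x \<notin> dyadic_grid N \<longrightarrow>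
    mesh (c + 2 powr k * x) = 2 powr k * mesh x"
proof -
  obtain m :: int and n where c_eq: "c = of_int m / 2 ^ n" using assms by (auto simp: dyadic_def)
  have "mesh (c + 2 powr k * x) = 2 powr k * mesh x"
    if N_ge: "N \<ge> n + nat \<bar>k\<bar>" and off_grid: "dyadic x" "x \<notin> dyadic_grid N" for N x
  proof -
    obtain j :: int and d where x_odd: "odd j" "N < d" "x = of_int j / 2 ^ d"
      using off_grid by (rule dyadic_odd_numerator)
    define e where "e = nat (int d - k)"
    have exponent: "real_of_int k = real d - real e" "n < e"
      using N_ge x_odd(2) by (auto simp: e_def)
    have scale: "2 powr k / 2 ^ d = 1 / (2::real) ^ e"
      by (simp add: exponent(1) powr_diff powr_realpow)
    have "(2::real) ^ e = 2 ^ n * 2 ^ (e - n)" using exponent(2) by (simp flip: power_add)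
    then have "c = of_int (m * 2 ^ (e - n)) / 2 ^ e" by (simp add: c_eq)
    moreover have "2 powr k * x = of_int j * (2 powr k / 2 ^ d)" by (simp add: x_odd(3))
    ultimately have "c + 2 powr k * x = of_int (m * 2 ^ (e - n) + j) / 2 ^ e"
      by (simp add: scale add_divide_distrib)
    moreover have "odd (m * 2 ^ (e - n) + j)" using x_odd(1) exponent(2) by simp
    ultimately have "mesh (c + 2 powr k * x) = 1 / 2 ^ e" by (metis mesh_odd)
    then show ?thesis using mesh_odd[OF x_odd(1), of d] by (simp add: x_odd(3) scale)
  qed
  then show ?thesis unfolding eventually_sequentially by blast
qed

definition scales_mesh_at :: "(real \<Rightarrow> real) \<Rightarrow> real \<Rightarrow> bool" where
  "scales_mesh_at F x \<longleftrightarrow>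
     F (x - mesh x) = F x - mesh (F x) \<and> F (x + mesh x) = F x + mesh (F x)"

lemma (in circle_lift) scales_mesh_at_frac_iff:
  "scales_mesh_at F (frac x) \<longleftrightarrow> scales_mesh_at F x"
proof -
  have "F (frac x - mesh x) = F (x - mesh x) - of_int \<lfloor>x\<rfloor>"
    "F (frac x + mesh x) = F (x + mesh x) - of_int \<lfloor>x\<rfloor>"
    "F (frac x) = F x - of_int \<lfloor>x\<rfloor>"
    using diff_int[of "x - mesh x" "\<lfloor>x\<rfloor>"] diff_int[of "x + mesh x" "\<lfloor>x\<rfloor>"]
    by (simp_all add: frac_def algebra_simps)
  moreover have "mesh (frac x) = mesh x" by (simp add: frac_def mesh_diff_int)
  ultimately show ?thesis by (simp add: scales_mesh_at_def mesh_diff_int)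
qed

context thompson_circle_lift
begin

lemma eventually_scales_mesh_on_cell:
  assumes breakpoints_grid: "breakpoints F \<subseteq> dyadic_grid M"
  shows "\<forall>\<^sub>F N in sequentially. \<forall>x\<in>dyadic_cell M i.
    dyadic x \<longrightarrow> x \<notin> dyadic_grid N \<longrightarrow> scales_mesh_at F x"
proof -
  define a b where "a = real_of_int i / 2 ^ M" and "b = real_of_int (i + 1) / 2 ^ M"
  obtain k :: int where affine_cell: "\<And>x. x \<in> dyadic_cell M i \<Longrightarrow> F x = F a + 2 powr k * (x - a)"
    using affine_on_cell[OF breakpoints_grid, of i] unfolding a_def by blast
  define c where "c = F a - 2 powr k * a"
  have affine: "F x = c + 2 powr k * x" if "x \<in> dyadic_cell M i" for x
    using affine_cell[OF that] by (simp add: c_def algebra_simps)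
  have "dyadic a" by (simp add: a_def dyadic_divide_power2)
  then have "dyadic c" by (simp add: c_def dyadic_diff dyadic_iff dyadic_powr_mult)
  then have "\<forall>\<^sub>F N in sequentially. \<forall>x. dyadic x \<longrightarrow> x \<notin> dyadic_grid N \<longrightarrow>
      mesh (c + 2 powr k * x) = 2 powr k * mesh x"
    by (rule eventually_mesh_affine)
  then show ?thesis using eventually_ge_at_top[of M]
  proof eventually_elim
    case (elim N)
    show ?case
    proof (intro ballI impI)
      fix x assume x_cell: "x \<in> dyadic_cell M i" "dyadic x" "x \<notin> dyadic_grid N"
      then have "x \<notin> dyadic_grid M" using dyadic_grid_mono[OF elim(2)] by blast
      then have "mesh x \<le> \<bar>x - a\<bar>" "mesh x \<le> \<bar>x - b\<bar>"
        unfolding a_def b_def using x_cell(2) by (blast intro: mesh_le_dist dyadic_gridI)+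
      then have "x - mesh x \<in> dyadic_cell M i" "x + mesh x \<in> dyadic_cell M i"
        using x_cell(1) mesh_pos[of x]
        unfolding dyadic_cell_def a_def[symmetric] b_def[symmetric] by auto
      then show "scales_mesh_at F x"
        using elim(1) x_cell by (simp add: scales_mesh_at_def affine algebra_simps)
    qed
  qed
qed

lemma scales_mesh_off_grid:
  obtains N where "\<And>x. dyadic x \<Longrightarrow> x \<notin> dyadic_grid N \<Longrightarrow> scales_mesh_at F x"
proof -
  obtain M where breakpoints_grid: "breakpoints F \<subseteq> dyadic_grid M" using breakpoints_subset_grid ..
  have "\<forall>\<^sub>F N in sequentially. \<forall>i\<in>{0..<2 ^ M}. \<forall>x\<in>dyadic_cell M i.
      dyadic x \<longrightarrow> x \<notin> dyadic_grid N \<longrightarrow> scales_mesh_at F x"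
    by (intro eventually_ball_finite ballI eventually_scales_mesh_on_cell breakpoints_grid) simp
  then obtain N where scales_unit: "\<forall>i\<in>{0..<2 ^ M}. \<forall>x\<in>dyadic_cell M i.
      dyadic x \<longrightarrow> x \<notin> dyadic_grid N \<longrightarrow> scales_mesh_at F x"
    using eventually_happens'[OF sequentially_bot] by blast
  have "scales_mesh_at F x" if "dyadic x" "x \<notin> dyadic_grid N" for x
  proof -
    obtain i where "i \<in> {0..<2 ^ M}" "frac x \<in> dyadic_cell M i" by (rule frac_in_dyadic_cell)
    then show ?thesis
      using scales_unit that dyadic_frac_iff dyadic_grid_frac_iff scales_mesh_at_frac_iff by blast
  qed
  then show ?thesis using that by blast
qed

end

section \<open>Periodic points\<close>

context circle_lift
begin

definition wandering :: "real set \<Rightarrow> bool" where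
  "wandering U \<longleftrightarrow> (\<forall>k. \<forall>x\<in>U. \<forall>y\<in>U. (F ^^ k) x - y \<in> \<int> \<longrightarrow> (\<forall>z. (F ^^ k) z - z \<in> \<int>))"

definition contracts :: "real \<Rightarrow> real \<Rightarrow> bool" where
  "contracts a b \<longleftrightarrow> (\<lambda>n. (F ^^ n) b - (F ^^ n) a) \<longlonglongrightarrow> 0"

definition contracted :: "real set" where
  "contracted = \<Union>{{a<..<b} | a b. contracts a b}"

lemma contractedI: "contracts a b \<Longrightarrow> a < x \<Longrightarrow> x < b \<Longrightarrow> x \<in> contracted"
  unfolding contracted_def by (rule UnionI[of "{a<..<b}"]) auto

lemma contractedE:
  assumes "x \<in> contracted"
  obtains a b where "contracts a b" "a < x" "x < b"
  using assms unfolding contracted_def by auto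

lemma open_contracted: "open contracted"
  unfolding contracted_def by (rule open_Union) auto

lemma contracts_mono:
  assumes "contracts a b" "a \<le> a'" "a' \<le> b'" "b' \<le> b"
  shows "contracts a' b'"
  unfolding contracts_def
proof (rule real_tendsto_sandwich[OF _ _ tendsto_const assms(1)[unfolded contracts_def]])
  show "\<forall>\<^sub>F n in sequentially. 0 \<le> (F ^^ n) b' - (F ^^ n) a'"
    using assms(3) by simp
  have "(F ^^ n) b' - (F ^^ n) a' \<le> (F ^^ n) b - (F ^^ n) a" for n
    using assms(2,4) by (intro diff_mono) simp_all
  then show "\<forall>\<^sub>F n in sequentially. (F ^^ n) b' - (F ^^ n) a' \<le> (F ^^ n) b - (F ^^ n) a"
    by simp
qed

lemma contracts_trans: "contracts a b \<Longrightarrow> contracts b c \<Longrightarrow> contracts a c"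
  unfolding contracts_def by (drule (1) tendsto_add) simp

lemma contracts_Icc:
  assumes "a \<le> b" "{a..b} \<subseteq> contracted"
  shows "contracts a b"
  using assms(1)
proof (rule Bolzano)
  fix x assume "a \<le> x" "x \<le> b"
  then have "x \<in> contracted" using assms(2) by auto
  then obtain c d where contracts_cd: "contracts c d" "c < x" "x < d" by (rule contractedE)
  show "\<exists>e>0. \<forall>a b. a \<le> x \<and> x \<le> b \<and> b - a < e \<longrightarrow> contracts a b"
    using contracts_cd(2,3) by (intro exI[of _ "min (x - c) (d - x)"])
      (auto intro: contracts_mono[OF contracts_cd(1)])
qed (rule contracts_trans)

lemma contracts_apply_iff: "contracts (F a) (F b) \<longleftrightarrow> contracts a b"
  unfolding contracts_def
  using filterlim_sequentially_Suc[of "\<lambda>n. (F ^^ n) b - (F ^^ n) a" "nhds 0"]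
  by (simp add: funpow_swap1)

lemma contracted_apply_iff: "F x \<in> contracted \<longleftrightarrow> x \<in> contracted"
proof
  assume "F x \<in> contracted"
  then obtain a b where "contracts a b" "a < F x" "F x < b" by (rule contractedE)
  moreover obtain a' b' where "a = F a'" "b = F b'" using surj by (metis surjD)
  ultimately show "x \<in> contracted" using contractedI[of a' b' x] by (simp add: contracts_apply_iff)
next
  assume "x \<in> contracted"
  then obtain a b where "contracts a b" "a < x" "x < b" by (rule contractedE)
  then show "F x \<in> contracted"
    using contractedI[of "F a" "F b" "F x"] by (simp add: contracts_apply_iff)
qed

lemma contracted_funpow_iff: "(F ^^ n) x \<in> contracted \<longleftrightarrow> x \<in> contracted"
  by (induction n) (simp_all add: contracted_apply_iff)

lemma contracted_add_int:
  assumes "x \<in> contracted"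
  shows "x + of_int m \<in> contracted"
proof -
  obtain a b where "contracts a b" "a < x" "x < b" using assms by (rule contractedE)
  then show ?thesis
    using contractedI[of "a + of_int m" "b + of_int m" "x + of_int m"] by (simp add: contracts_def)
qed

lemma contracted_add_int_iff: "x + of_int m \<in> contracted \<longleftrightarrow> x \<in> contracted"
  using contracted_add_int[of x m] contracted_add_int[of "x + of_int m" "- m"] by auto

lemma contracted_gap_end:
  assumes "x \<in> contracted"
  obtains a where "x < a" "a \<notin> contracted" "{x..<a} \<subseteq> contracted"
proof -
  define C where "C = {x..} \<inter> - contracted"
  have "C \<noteq> {}"
  proof
    assume "C = {}"
    then have "contracts x (x + 1)" by (intro contracts_Icc) (auto simp: C_def)
    moreover have "(F ^^ n) (x + 1) - (F ^^ n) x = 1" for n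
      using funpow_add_int[of n x 1] by simp
    ultimately show False by (simp add: contracts_def LIMSEQ_const_iff)
  qed
  moreover have bdd_below_C: "bdd_below C" by (rule bdd_belowI[of _ x]) (simp add: C_def)
  moreover have "closed C"
    unfolding C_def by (intro closed_Int closed_atLeast closed_Compl open_contracted)
  ultimately have "Inf C \<in> C" by (rule closed_contains_Inf)
  then have "Inf C \<notin> contracted" "x \<le> Inf C" by (simp_all add: C_def)
  moreover have "{x..<Inf C} \<subseteq> contracted"
    using cInf_lower[OF _ bdd_below_C] by (fastforce simp: C_def)
  ultimately show ?thesis using that[of "Inf C"] assms by (metis order_le_less)
qed

lemma contracts_reflect:
  assumes "e > 0"
    and symmetric: "\<And>z h. z \<notin> contracted \<Longrightarrow> 0 \<le> h \<Longrightarrow> h < e \<Longrightarrow> F (z + h) - F z = F z - F (z - h)"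
    and "x < a" "contracts x a"
  shows "a \<in> contracted"
proof (rule ccontr)
  assume "a \<notin> contracted"
  obtain N where close: "\<And>n. n \<ge> N \<Longrightarrow> \<bar>(F ^^ n) a - (F ^^ n) x\<bar> < e"
    using LIMSEQ_D[OF assms(4)[unfolded contracts_def] \<open>e > 0\<close>] by auto
  define b l where "b = (F ^^ N) a" and "l = (F ^^ N) a - (F ^^ N) x"
  have "l > 0" using \<open>x < a\<close> by (simp add: l_def)
  have shift: "(F ^^ n) ((F ^^ N) y) = (F ^^ (n + N)) y" for n y by (simp add: funpow_add)
  have "(F ^^ n) (b + l) - (F ^^ n) b = (F ^^ n) b - (F ^^ n) (b - l)" for n
  proof (induction n)
    case (Suc n)
    define z h where "z = (F ^^ n) b" and "h = (F ^^ n) b - (F ^^ n) (b - l)"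
    have "z \<notin> contracted" using \<open>a \<notin> contracted\<close> by (simp add: z_def b_def contracted_funpow_iff)
    moreover have "0 \<le> h" using \<open>l > 0\<close> by (simp add: h_def)
    moreover have "h < e" using close[of "n + N"] by (simp add: h_def b_def l_def shift)
    ultimately have "F (z + h) - F z = F z - F (z - h)" by (rule symmetric)
    moreover have "(F ^^ n) (b + l) = z + h" using Suc by (simp add: z_def h_def)
    ultimately show ?case by (simp add: z_def h_def)
  qed simp
  moreover have left: "contracts (b - l) b"
    using LIMSEQ_ignore_initial_segment[OF assms(4)[unfolded contracts_def], of N]
    by (simp add: contracts_def b_def l_def shift)
  ultimately have "contracts b (b + l)" by (simp add: contracts_def)
  with left have "contracts (b - l) (b + l)" by (rule contracts_trans)
  then have "b \<in> contracted" using \<open>l > 0\<close> by (auto intro: contractedI)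
  with \<open>a \<notin> contracted\<close> show False by (simp add: b_def contracted_funpow_iff)
qed

end

locale aperiodic_circle_lift = circle_lift +
  assumes aperiodic: "0 < k \<Longrightarrow> (F ^^ k) x - x \<notin> \<int>"
begin

lemma wanderingD:
  assumes "wandering U" "0 < k" "x \<in> U" "y \<in> U"
  shows "(F ^^ k) x - y \<notin> \<int>"
  using assms aperiodic unfolding wandering_def by blast

lemma wandering_singleton: "wandering {x}"
  using aperiodic unfolding wandering_def by (metis diff_self funpow_0 Ints_0 gr0I singletonD)

lemma wandering_gap:
  assumes "a \<notin> contracted" "{b..<a} \<subseteq> contracted"
  shows "wandering {b..<a}"
  unfolding wandering_def
proof (intro allI ballI impI)
  fix k x y z assume x: "x \<in> {b..<a}" and y: "y \<in> {b..<a}" and "(F ^^ k) x - y \<in> \<int>"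
  then obtain m :: int where congruent: "(F ^^ k) x - y = of_int m" by (auto elim: Ints_cases)
  define H where "H z = (F ^^ k) z - of_int m" for z
  interpret H: circle_lift H
    unfolding H_def by (rule circle_lift.circle_lift_diff_int[OF circle_lift_funpow])
  have H_contracted: "H z \<in> contracted \<longleftrightarrow> z \<in> contracted" for z
    using contracted_add_int_iff[of "(F ^^ k) z" "- m"] by (simp add: H_def contracted_funpow_iff)
  have "H x = y" using congruent by (simp add: H_def)
  have "a \<le> H a"
  proof (rule ccontr)
    assume "\<not> a \<le> H a"
    moreover have "y < H a" using x H.less_iff[of x a] by (simp add: \<open>H x = y\<close>)
    ultimately have "H a \<in> contracted" using assms(2) y by auto
    with assms(1) show False by (simp add: H_contracted)
  qed
  moreover have "H a \<le> a"
  proof (rule ccontr)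
    assume "\<not> H a \<le> a"
    obtain w where H_w: "H w = a" using H.surj by (metis surjD)
    have "x < w" "w < a"
      using \<open>\<not> H a \<le> a\<close> y H.less_iff[of x w] H.less_iff[of w a] by (simp_all add: H_w \<open>H x = y\<close>)
    then have "w \<in> contracted" using assms(2) x by auto
    with assms(1) show False using H_contracted[of w] by (simp add: H_w)
  qed
  ultimately have "(F ^^ k) a - a = of_int m" by (simp add: H_def)
  then have "(F ^^ k) a - a \<in> \<int>" by simp
  then have "k = 0" using aperiodic by blast
  then show "(F ^^ k) z - z \<in> \<int>" by simp
qed

lemma finite_grid_visits:
  assumes "wandering U"
  shows "finite {n. (F ^^ n) ` U \<inter> dyadic_grid N \<noteq> {}}" (is "finite ?V")
proof -
  have "\<forall>n\<in>?V. \<exists>x. x \<in> U \<and> (F ^^ n) x \<in> dyadic_grid N" by auto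
  then obtain x where visit: "\<And>n. n \<in> ?V \<Longrightarrow> x n \<in> U" "\<And>n. n \<in> ?V \<Longrightarrow> (F ^^ n) (x n) \<in> dyadic_grid N"
    by metis
  define f where "f n = frac ((F ^^ n) (x n))" for n
  show ?thesis
  proof (rule finite_imageD)
    have "f ` ?V \<subseteq> dyadic_grid N \<inter> {0..1}"
      using visit(2) by (intro image_subsetI)
        (simp add: f_def dyadic_grid_frac_iff less_imp_le[OF frac_lt_1])
    then show "finite (f ` ?V)" by (rule finite_subset) (rule finite_dyadic_grid_Icc)
    show "inj_on f ?V"
    proof (rule linorder_inj_onI)
      fix n n' assume "n < n'" and in_V: "n \<in> ?V" "n' \<in> ?V"
      have "(F ^^ n') (x n') = (F ^^ n) ((F ^^ (n' - n)) (x n'))"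
        using \<open>n < n'\<close> by (simp flip: funpow_add comp_apply[of "F ^^ n"])
      moreover have "(F ^^ (n' - n)) (x n') - x n \<notin> \<int>"
        using \<open>n < n'\<close> in_V visit(1) by (intro wanderingD[OF assms]) auto
      ultimately have "frac ((F ^^ n') (x n')) \<noteq> frac ((F ^^ n) (x n))"
        by (simp add: frac_eq_frac_iff)
      then show "f n \<noteq> f n'" by (simp add: f_def)
    qed auto
  qed
qed

lemma eventually_avoids_grid:
  assumes "wandering U"
  shows "\<forall>\<^sub>F n in sequentially. (F ^^ n) ` U \<inter> dyadic_grid N = {}"
  using finite_grid_visits[OF assms, of N]
  by (simp add: eventually_cofinite flip: cofinite_eq_sequentially)

lemma contracts_if_wandering:
  assumes "b < a" "wandering {b..<a}"
  shows "contracts b a"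
  unfolding contracts_def
proof (rule LIMSEQ_I)
  fix r :: real assume "r > 0"
  then obtain N where N_large: "1 / 2 ^ N < r" by (rule inverse_power2_less)
  obtain M where avoids: "\<And>n. n \<ge> M \<Longrightarrow> (F ^^ n) ` {b..<a} \<inter> dyadic_grid N = {}"
    using eventually_avoids_grid[OF assms(2)] unfolding eventually_sequentially by blast
  have "norm ((F ^^ n) a - (F ^^ n) b - 0) < r" if "n \<ge> M" for n
  proof -
    have "\<not> 1 / 2 ^ N \<le> (F ^^ n) a - (F ^^ n) b"
    proof
      assume "1 / 2 ^ N \<le> (F ^^ n) a - (F ^^ n) b"
      then obtain g where grid_point: "g \<in> dyadic_grid N" "(F ^^ n) b \<le> g" "g < (F ^^ n) a"
        by (rule dyadic_grid_meets_Ico)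
      obtain x where "g = (F ^^ n) x" using funpow_surj by (metis surjD)
      with grid_point have "g \<in> (F ^^ n) ` {b..<a} \<inter> dyadic_grid N" by simp
      with avoids[OF \<open>n \<ge> M\<close>] show False by blast
    qed
    moreover have "(F ^^ n) b < (F ^^ n) a" using \<open>b < a\<close> by simp
    ultimately show ?thesis using N_large by simp
  qed
  then show "\<exists>M. \<forall>n\<ge>M. norm ((F ^^ n) a - (F ^^ n) b - 0) < r" by blast
qed

end

lemma (in circle_lift) symmetric_between_breakpoints:
  assumes "{z - h<..<z + h} \<inter> breakpoints F = {}" "0 \<le> h"
  shows "F (z + h) - F z = F z - F (z - h)"
proof (cases "h = 0")
  case False
  have "z - h < z + h" using False assms(2) by simp
  moreover have "continuous_on {z - h..z + h} F"
    using continuous by (rule continuous_on_subset) simp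
  ultimately obtain k :: int where
    affine: "\<And>x. x \<in> {z - h..z + h} \<Longrightarrow> F x = F (z - h) + 2 powr k * (x - (z - h))"
    using pow2_affine_on_Icc assms(1) by blast
  have "F z = F (z - h) + 2 powr k * h" "F (z + h) = F (z - h) + 2 powr k * (2 * h)"
    using affine[of z] affine[of "z + h"] assms(2) by simp_all
  then show ?thesis by simp
qed simp

lemma (in thompson_circle_lift) breakpoints_bounded_away:
  assumes "open W" "\<And>x m. x + of_int m \<in> W \<longleftrightarrow> x \<in> W" "breakpoints F \<subseteq> W"
  obtains e where "e > 0" "\<And>b z. b \<in> breakpoints F \<Longrightarrow> z \<notin> W \<Longrightarrow> e \<le> \<bar>b - z\<bar>"
proof -
  have "compact (breakpoints F \<inter> {-1..2})" using finite_breakpoints by (rule finite_imp_compact)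
  then obtain d where "d > 0"
    and dist_ge: "\<And>b z. b \<in> breakpoints F \<inter> {-1..2} \<Longrightarrow> z \<notin> W \<Longrightarrow> d \<le> \<bar>b - z\<bar>"
    using separate_compact_closed[of "breakpoints F \<inter> {-1..2}" "- W"] assms(1,3)
    by (force simp: dist_real_def)
  have "min d 1 \<le> \<bar>b - z\<bar>" if b: "b \<in> breakpoints F" and z: "z \<notin> W" for b z
  proof -
    define b' where "b' = b + of_int (- \<lfloor>z\<rfloor>)"
    have b': "b' \<in> breakpoints F" "b' - frac z = b - z"
      using b breakpoints_add_int_iff[of b "- \<lfloor>z\<rfloor>"] by (simp_all add: b'_def frac_def)
    have "frac z \<notin> W" using z assms(2)[of z "- \<lfloor>z\<rfloor>"] by (simp add: frac_def)
    then have "d \<le> \<bar>b' - frac z\<bar>" if "b' \<in> {-1..2}" using dist_ge b'(1) that by blast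
    moreover have "1 \<le> \<bar>b' - frac z\<bar>" if "b' \<notin> {-1..2}"
      using that frac_lt_1[of z] frac_ge_0[of z] unfolding atLeastAtMost_iff by linarith
    ultimately show ?thesis unfolding b'(2) by linarith
  qed
  moreover have "min d 1 > 0" using \<open>d > 0\<close> by simp
  ultimately show ?thesis using that by blast
qed

locale aperiodic_thompson_lift = thompson_circle_lift + aperiodic_circle_lift
begin

lemma eventually_orbit_off_grid: "\<forall>\<^sub>F n in sequentially. (F ^^ n) x \<notin> dyadic_grid N"
  using eventually_avoids_grid[OF wandering_singleton, of x N] by simp

lemma dyadic_funpow_iff: "dyadic ((F ^^ n) x) \<longleftrightarrow> dyadic x"
  using thompson_circle_lift.dyadic_iff[OF thompson_circle_lift_funpow] .

lemma mesh_orbit_tendsto_0: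
  assumes "dyadic x"
  shows "(\<lambda>n. mesh ((F ^^ n) x)) \<longlonglongrightarrow> 0"
proof (rule order_tendstoI)
  fix r :: real assume "0 < r"
  then obtain N where "1 / 2 ^ N < r" by (rule inverse_power2_less)
  then have "mesh ((F ^^ n) x) < r" if "(F ^^ n) x \<notin> dyadic_grid N" for n
    using mesh_less[OF _ that] assms by (simp add: dyadic_funpow_iff)
  then show "\<forall>\<^sub>F n in sequentially. mesh ((F ^^ n) x) < r"
    using eventually_orbit_off_grid[of x N] by (auto elim: eventually_mono)
next
  show "\<forall>\<^sub>F n in sequentially. r < mesh ((F ^^ n) x)" if "r < 0" for r
    using that mesh_pos order_less_trans by (intro always_eventually) blast
qed

lemma dyadic_contracted:
  assumes "dyadic x"
  shows "x \<in> contracted"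
proof -
  obtain N where scales_off_grid: "\<And>x. dyadic x \<Longrightarrow> x \<notin> dyadic_grid N \<Longrightarrow> scales_mesh_at F x"
    using scales_mesh_off_grid by blast
  obtain M where off_grid: "\<And>n. n \<ge> M \<Longrightarrow> (F ^^ n) x \<notin> dyadic_grid N"
    using eventually_orbit_off_grid unfolding eventually_sequentially by blast
  define z where "z = (F ^^ M) x"
  have dyadic_z: "dyadic z" using assms by (simp add: z_def dyadic_funpow_iff)
  have scales: "scales_mesh_at F ((F ^^ n) z)" for n
    using scales_off_grid off_grid[of "n + M"] dyadic_z
    by (simp add: dyadic_funpow_iff funpow_add z_def)
  have "(F ^^ n) (z - mesh z) = (F ^^ n) z - mesh ((F ^^ n) z) \<and>
      (F ^^ n) (z + mesh z) = (F ^^ n) z + mesh ((F ^^ n) z)" for n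
    using scales by (induction n) (simp_all add: scales_mesh_at_def)
  then have "(F ^^ n) (z + mesh z) - (F ^^ n) (z - mesh z) = 2 * mesh ((F ^^ n) z)" for n
    by simp
  then have "contracts (z - mesh z) (z + mesh z)"
    using tendsto_mult_right_zero[OF mesh_orbit_tendsto_0[OF dyadic_z], of 2]
    by (simp add: contracts_def)
  then have "z \<in> contracted" using mesh_pos[of z] by (auto intro: contractedI)
  then show ?thesis by (simp add: z_def contracted_funpow_iff)
qed

end

theorem (in thompson_circle_lift) periodic_point_exists: "\<exists>k>0. \<exists>x. (F ^^ k) x - x \<in> \<int>"
proof (rule ccontr)
  assume "\<not> ?thesis"
  then interpret aperiodic_thompson_lift F by unfold_locales blast
  have "0 \<in> contracted" using dyadic_contracted[OF dyadic_of_int[of 0]] by simp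
  then obtain a where gap_end: "0 < a" "a \<notin> contracted" "{0..<a} \<subseteq> contracted"
    by (rule contracted_gap_end)
  then have "contracts 0 a" by (intro contracts_if_wandering wandering_gap)
  have "breakpoints F \<subseteq> contracted" using dyadic_breakpoints dyadic_contracted by blast
  with open_contracted contracted_add_int_iff obtain e where
    bounded_away: "e > 0" "\<And>b z. b \<in> breakpoints F \<Longrightarrow> z \<notin> contracted \<Longrightarrow> e \<le> \<bar>b - z\<bar>"
    using breakpoints_bounded_away[of contracted] by blast
  have "F (z + h) - F z = F z - F (z - h)" if "z \<notin> contracted" "0 \<le> h" "h < e" for z h
  proof (rule symmetric_between_breakpoints)
    show "{z - h<..<z + h} \<inter> breakpoints F = {}" using bounded_away(2) that by fastforce
  qed (rule that(2))
  with bounded_away(1) have "a \<in> contracted" using gap_end(1) \<open>contracts 0 a\<close>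
    by (rule contracts_reflect)
  with gap_end(2) show False ..
qed

section \<open>Wandering intervals\<close>

lemma (in circle_lift) funpow_mult_diff_in_Ints:
  assumes "(F ^^ q) x - x \<in> \<int>"
  shows "(F ^^ (q * t)) x - x \<in> \<int>"
proof (induction t)
  case (Suc t)
  have "(F ^^ (q * Suc t)) x = (F ^^ (q * t)) ((F ^^ q) x)"
    by (simp add: algebra_simps flip: funpow_add comp_apply[of "F ^^ (q * t)"])
  then have "(F ^^ (q * Suc t)) x - (F ^^ (q * t)) x \<in> \<int>" using assms by simp
  from Ints_add[OF this Suc] show ?case by simp
qed simp

lemma (in circle_lift) funpow_mod_diff_in_Ints:
  assumes "(F ^^ q) x - x \<in> \<int>"
  shows "(F ^^ k) x - (F ^^ (k mod q)) x \<in> \<int>"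
proof -
  have "(F ^^ k) x = (F ^^ (k mod q)) ((F ^^ (q * (k div q))) x)"
    by (simp flip: funpow_add comp_apply[of "F ^^ (k mod q)"])
  then show ?thesis by (simp add: funpow_mult_diff_in_Ints[OF assms])
qed

lemma (in circle_lift) wandering_interval_if_identity_power:
  assumes "0 < q" "\<And>z. (F ^^ q) z - z \<in> \<int>"
    and least: "\<And>r. 0 < r \<Longrightarrow> r < q \<Longrightarrow> (F ^^ r) 0 - 0 \<notin> \<int>"
  obtains u v where "u < v" "wandering {u<..<v}"
proof -
  define W where "W = (\<Inter>r\<in>{1..<q}. (\<lambda>p. (F ^^ r) (fst p) - snd p) -` (- \<int>))"
  have "open W" unfolding W_def
  proof (intro open_INT ballI open_vimage open_Compl closed_Ints continuous_intros)
    show "continuous_on UNIV (\<lambda>p. (F ^^ r) (fst p))" for r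
      by (rule continuous_on_compose2[OF circle_lift.continuous[OF circle_lift_funpow]])
        (auto intro: continuous_intros)
  qed simp
  moreover have "(0, 0) \<in> W" using least by (auto simp: W_def)
  ultimately obtain A B where box: "open A" "open B" "(0, 0) \<in> A \<times> B" "A \<times> B \<subseteq> W"
    by (rule open_prod_elim)
  have "open (A \<inter> B)" "0 \<in> A \<inter> B" using box(1-3) by auto
  then obtain e where "e > 0" and ball_subset: "ball 0 e \<subseteq> A \<inter> B" by (rule openE)
  have "wandering {- e<..<e}"
    unfolding wandering_def
  proof (intro allI ballI impI)
    fix k x y z assume in_interval: "x \<in> {- e<..<e}" "y \<in> {- e<..<e}" and "(F ^^ k) x - y \<in> \<int>"
    have congruent: "(F ^^ k) z - (F ^^ (k mod q)) z \<in> \<int>" for z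
      by (rule funpow_mod_diff_in_Ints[OF assms(2)])
    have "(F ^^ (k mod q)) x - y \<in> \<int>"
      using Ints_diff[OF \<open>(F ^^ k) x - y \<in> \<int>\<close> congruent[of x]] by simp
    moreover have "x \<in> ball 0 e" "y \<in> ball 0 e" using in_interval by auto
    then have "(x, y) \<in> W" using ball_subset box(4) by blast
    ultimately have "k mod q \<notin> {1..<q}" unfolding W_def by auto
    then have "k mod q = 0" using \<open>0 < q\<close> by (simp add: not_le)
    then show "(F ^^ k) z - z \<in> \<int>" using congruent[of z] by simp
  qed
  then show ?thesis using that[of "- e" e] \<open>e > 0\<close> by simp
qed

definition fundamental_interval :: "(real \<Rightarrow> real) \<Rightarrow> real \<Rightarrow> real set" where
  "fundamental_interval G c = {min c (G c)<..<max c (G c)}"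

lemma funpow_leaves_fundamental_interval:
  assumes G: "strict_mono G" and x: "x \<in> fundamental_interval G c" and "0 < t"
  shows "(G ^^ t) x \<notin> fundamental_interval G c"
proof -
  obtain s where t: "t = Suc s" using \<open>0 < t\<close> gr0_implies_Suc by blast
  note G_less_iff = strict_mono_less[OF G]
  show ?thesis
  proof (cases "c < G c")
    case True
    have "G c < (G ^^ Suc s) x"
    proof (induction s)
      case 0
      show ?case using True x by (simp add: fundamental_interval_def G_less_iff)
    next
      case (Suc s)
      with True have "c < (G ^^ Suc s) x" by simp
      then show ?case by (simp add: G_less_iff)
    qed
    then show ?thesis using True by (simp add: t fundamental_interval_def)
  next
    case False
    have "(G ^^ Suc s) x < G c"
    proof (induction s)
      case 0
      show ?case using False x by (simp add: fundamental_interval_def G_less_iff)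
    next
      case (Suc s)
      with False have "(G ^^ Suc s) x < c" by simp
      then show ?case by (simp add: G_less_iff)
    qed
    then show ?thesis using False by (simp add: t fundamental_interval_def)
  qed
qed

lemma commuting_fixes_gap_end:
  assumes "circle_lift G" "circle_lift H" and comm: "\<And>z. H (G z) = G (H z)"
    and gap_end: "G a = a" "a \<le> c" "\<And>w. G w = w \<Longrightarrow> w \<le> c \<Longrightarrow> w \<le> a"
    and in_interval: "x \<in> fundamental_interval G c" "H x \<in> fundamental_interval G c"
  shows "H a = a"
proof (rule antisym)
  interpret G: circle_lift G by fact
  interpret H: circle_lift H by fact
  have "a < x" "a < H x"
    using in_interval gap_end(1,2) G.less_iff[of a c]
    by (auto simp: fundamental_interval_def min_def split: if_splits)
  have fixed_le: "w \<le> a" if fixed: "G w = w" "w < y" "y \<in> fundamental_interval G c" for w y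
  proof (rule gap_end(3)[OF fixed(1)], rule ccontr)
    assume "\<not> w \<le> c"
    then have "G c < w" using G.less_iff[of c w] fixed(1) by simp
    with \<open>\<not> w \<le> c\<close> fixed(2,3) show False
      by (auto simp: fundamental_interval_def max_def split: if_splits)
  qed
  have "G (H a) = H a" by (simp add: gap_end(1) flip: comm)
  then show "H a \<le> a" using \<open>a < x\<close> in_interval(2) by (intro fixed_le) auto
  obtain w where H_w: "H w = a" using H.surj by (metis surjD)
  have "H (G w) = H w" by (simp add: comm H_w gap_end(1))
  then have "G w = w" by simp
  moreover have "w < x" using H.less_iff[of w x] \<open>a < H x\<close> by (simp add: H_w)
  ultimately have "w \<le> a" using in_interval(1) by (intro fixed_le)
  then show "a \<le> H a" using H.le_iff[of w a] by (simp add: H_w)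
qed

lemma (in circle_lift) greatest_fixpoint_below:
  assumes "F b = b"
  obtains a where "F a = a" "a \<le> c" "\<And>w. F w = w \<Longrightarrow> w \<le> c \<Longrightarrow> w \<le> a"
proof -
  define Q where "Q = {x. F x = x} \<inter> {..c}"
  have "b + of_int \<lfloor>c - b\<rfloor> \<in> Q" using assms by (simp add: Q_def) linarith
  moreover have bdd_above_Q: "bdd_above Q" by (rule bdd_aboveI[of _ c]) (simp add: Q_def)
  moreover have "closed Q" unfolding Q_def
    by (intro closed_Int closed_Collect_eq continuous closed_atMost continuous_on_id)
  ultimately have "Sup Q \<in> Q" by (intro closed_contains_Sup) auto
  then show ?thesis using that[of "Sup Q"] cSup_upper[OF _ bdd_above_Q] by (simp add: Q_def)
qed

lemma (in circle_lift) funpow_multiple_of_least_period: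
  fixes m p :: int
  assumes "0 < q" and least: "\<And>r x. 0 < r \<Longrightarrow> r < q \<Longrightarrow> (F ^^ r) x - x \<notin> \<int>"
    and period_q: "(F ^^ q) a = a + p" and period_k: "(F ^^ k) a = a + m"
  obtains t where "k = q * t" "\<And>x. ((\<lambda>x. (F ^^ q) x - p) ^^ t) x = (F ^^ k) x - m"
proof -
  have "(F ^^ q) a - a \<in> \<int>" by (simp add: period_q)
  then have "(F ^^ k) a - (F ^^ (k mod q)) a \<in> \<int>" by (rule funpow_mod_diff_in_Ints)
  from Ints_diff[OF Ints_of_int[of m] this] have "(F ^^ (k mod q)) a - a \<in> \<int>"
    by (simp add: period_k)
  then have "k mod q = 0" using least[of "k mod q" a] \<open>0 < q\<close> by auto
  then obtain t where k_eq: "k = q * t" by auto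
  have iterate: "((\<lambda>x. (F ^^ q) x - p) ^^ t) x = (F ^^ k) x - of_int (int t * p)" for x
    using circle_lift.funpow_diff_int[OF circle_lift_funpow[of q], where n = t and p = p and x = x]
    by (simp add: k_eq funpow_mult)
  have "((\<lambda>x. (F ^^ q) x - p) ^^ t) a = a" by (induction t) (simp_all add: period_q)
  then have "real_of_int m = of_int (int t * p)" using iterate[of a] period_k by simp
  with k_eq iterate show ?thesis using that by metis
qed

lemma (in circle_lift) wandering_fundamental_interval:
  fixes p :: int
  assumes "0 < q" "(F ^^ q) b = b + p"
    and least: "\<And>r x. 0 < r \<Longrightarrow> r < q \<Longrightarrow> (F ^^ r) x - x \<notin> \<int>"
  shows "wandering (fundamental_interval (\<lambda>x. (F ^^ q) x - p) c)"
  unfolding wandering_def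
proof (intro allI ballI impI)
  define G where "G = (\<lambda>x. (F ^^ q) x - of_int p)"
  fix k x y z
  assume "x \<in> fundamental_interval (\<lambda>x. (F ^^ q) x - p) c"
    "y \<in> fundamental_interval (\<lambda>x. (F ^^ q) x - p) c" "(F ^^ k) x - y \<in> \<int>"
  then obtain m :: int where x: "x \<in> fundamental_interval G c" and y: "y \<in> fundamental_interval G c"
    and "(F ^^ k) x - y = of_int m" by (auto elim: Ints_cases simp: G_def)
  define H where "H = (\<lambda>z. (F ^^ k) z - of_int m)"
  have "H x = y" using \<open>(F ^^ k) x - y = of_int m\<close> by (simp add: H_def)
  interpret G: circle_lift G
    unfolding G_def by (rule circle_lift.circle_lift_diff_int[OF circle_lift_funpow])
  have lift_H: "circle_lift H"
    unfolding H_def by (rule circle_lift.circle_lift_diff_int[OF circle_lift_funpow])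
  have comm: "H (G z) = G (H z)" for z
    by (simp add: H_def G_def circle_lift.diff_int[OF circle_lift_funpow] add.commute
        flip: funpow_add comp_apply[of "F ^^ k"] comp_apply[of "F ^^ q"])
  have "G b = b" using assms(2) by (simp add: G_def)
  then obtain a where greatest_fixpoint: "G a = a" "a \<le> c" "\<And>w. G w = w \<Longrightarrow> w \<le> c \<Longrightarrow> w \<le> a"
    using G.greatest_fixpoint_below[of b c] by blast
  have "H a = a"
    using commuting_fixes_gap_end[OF G.circle_lift_axioms lift_H comm greatest_fixpoint x] y
    by (simp add: \<open>H x = y\<close>)
  with greatest_fixpoint(1) have "(F ^^ q) a = a + p" "(F ^^ k) a = a + m"
    by (simp_all add: G_def H_def)
  then obtain t where multiple: "k = q * t" "\<And>x. (G ^^ t) x = (F ^^ k) x - m"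
    unfolding G_def using funpow_multiple_of_least_period[OF assms(1) least] by blast
  have "(G ^^ t) x \<in> fundamental_interval G c"
    using multiple(2)[of x] y \<open>H x = y\<close> by (simp add: H_def)
  then have "t = 0" using funpow_leaves_fundamental_interval[OF G.strict_mono x] by blast
  then show "(F ^^ k) z - z \<in> \<int>" by (simp add: multiple)
qed

theorem (in circle_lift) wandering_interval_exists:
  assumes "\<exists>k>0. \<exists>x. (F ^^ k) x - x \<in> \<int>"
  obtains u v where "u < v" "wandering {u<..<v}"
proof -
  obtain q where "0 < q" "\<exists>x. (F ^^ q) x - x \<in> \<int>"
    and least: "\<And>r x. 0 < r \<Longrightarrow> r < q \<Longrightarrow> (F ^^ r) x - x \<notin> \<int>"
    using assms exists_least_iff[of "\<lambda>k. 0 < k \<and> (\<exists>x. (F ^^ k) x - x \<in> \<int>)"] by blast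
  then obtain b and p :: int where "(F ^^ q) b - b = of_int p" by (auto elim: Ints_cases)
  then have period_b: "(F ^^ q) b = b + of_int p" by simp
  show ?thesis
  proof (cases "\<forall>z. (F ^^ q) z - z \<in> \<int>")
    case True
    then show ?thesis
      using wandering_interval_if_identity_power[OF \<open>0 < q\<close> _ least] that by blast
  next
    case False
    then obtain c where "(F ^^ q) c - c \<notin> \<int>" by blast
    then have "(F ^^ q) c - of_int p \<noteq> c"
      by (metis Ints_of_int add_diff_cancel_left' diff_add_cancel)
    then have "min c ((F ^^ q) c - of_int p) < max c ((F ^^ q) c - of_int p)" by linarith
    then show ?thesis
      using wandering_fundamental_interval[OF \<open>0 < q\<close> period_b least, of c]
      unfolding fundamental_interval_def by (rule that)
  qed
qed

section \<open>Squeezing the complement of an interval into another interval\<close>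

definition equivariant_extension :: "(real \<Rightarrow> real) \<Rightarrow> real \<Rightarrow> real" where
  "equivariant_extension f x = of_int \<lfloor>x\<rfloor> + f (frac x)"

lemma equivariant_extension_eq: "0 \<le> x \<Longrightarrow> x < 1 \<Longrightarrow> equivariant_extension f x = f x"
  by (simp add: equivariant_extension_def frac_eq floor_eq_iff)

lemma strict_mono_equivariant_extension:
  assumes mono: "\<And>x y. 0 \<le> x \<Longrightarrow> x < y \<Longrightarrow> y \<le> 1 \<Longrightarrow> f x < f y"
    and ends: "f 0 = 0" "f 1 = 1"
  shows "strict_mono (equivariant_extension f)"
proof (rule strict_monoI)
  fix x y :: real assume "x < y"
  have "0 \<le> f (frac y)"
    using mono[of 0 "frac y"] ends(1) frac_ge_0[of y] frac_lt_1[of y] by (metis order_le_less)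
  have "f (frac x) < 1" using mono[of "frac x" 1] ends frac_lt_1[of x] by simp
  from \<open>x < y\<close> consider "\<lfloor>x\<rfloor> < \<lfloor>y\<rfloor>" | "\<lfloor>x\<rfloor> = \<lfloor>y\<rfloor>" "frac x < frac y"
    using floor_mono[of x y] by (force simp: frac_def)
  then show "equivariant_extension f x < equivariant_extension f y"
  proof cases
    case 1
    then have "real_of_int \<lfloor>x\<rfloor> + 1 \<le> of_int \<lfloor>y\<rfloor>" by linarith
    with \<open>f (frac x) < 1\<close> \<open>0 \<le> f (frac y)\<close> show ?thesis
      unfolding equivariant_extension_def by linarith
  next
    case 2
    then show ?thesis
      using mono[of "frac x" "frac y"] frac_lt_1[of y] by (simp add: equivariant_extension_def)
  qed
qed

lemma surj_equivariant_extension: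
  assumes "continuous_on {0..1} f" "f 0 = 0" "f 1 = 1"
  shows "surj (equivariant_extension f)"
proof -
  have "\<exists>x. y = equivariant_extension f x" for y
  proof -
    obtain t where preimage: "0 \<le> t" "t \<le> 1" "f t = frac y"
      using IVT'[of f 0 "frac y" 1] assms frac_lt_1[of y] by (auto intro: less_imp_le)
    then have "t \<noteq> 1" using assms(3) frac_lt_1[of y] by auto
    then have "frac t = t" "\<lfloor>t\<rfloor> = 0" using preimage by (simp_all add: frac_eq floor_eq_iff)
    then have "equivariant_extension f (of_int \<lfloor>y\<rfloor> + t) = of_int \<lfloor>y\<rfloor> + frac y"
      using preimage(3) by (simp add: equivariant_extension_def)
    then have "y = equivariant_extension f (of_int \<lfloor>y\<rfloor> + t)" by (simp add: frac_def)
    then show ?thesis ..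
  qed
  then show ?thesis by (simp add: surj_def)
qed

text \<open>The standard generator \<open>x\<^sub>0\<close> of Thompson's group \<open>F\<close>.\<close>

definition x0 :: "real \<Rightarrow> real" where
  "x0 t = min (2 * t) (min (t + 1 / 4) ((t + 1) / 2))"

definition x0_lift :: "real \<Rightarrow> real" where
  "x0_lift = equivariant_extension x0"

lemma x0_lift_eq: "0 \<le> x \<Longrightarrow> x < 1 \<Longrightarrow> x0_lift x = x0 x"
  by (simp add: x0_lift_def equivariant_extension_eq)

lemma circle_lift_x0_lift: "circle_lift x0_lift"
  unfolding x0_lift_def
proof (rule circle_lift_surjI)
  have ends: "x0 0 = 0" "x0 1 = 1" by (simp_all add: x0_def)
  show "strict_mono (equivariant_extension x0)"
    using ends by (rule strict_mono_equivariant_extension[rotated]) (simp add: x0_def min_def)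
  have "continuous_on {0..1} x0" unfolding x0_def[abs_def] by (intro continuous_intros) simp
  then show "surj (equivariant_extension x0)" using ends by (rule surj_equivariant_extension)
qed (simp add: equivariant_extension_def frac_1_eq)

lemma dyadic_x0_iff: "dyadic (x0 t) \<longleftrightarrow> dyadic t"
proof -
  have double: "dyadic (2 * s) \<longleftrightarrow> dyadic s" for s
    using dyadic_powr_mult[of s 1] dyadic_powr_mult[of "2 * s" "-1"] by (auto simp: powr_minus)
  have "dyadic (t + 1 / 4) \<longleftrightarrow> dyadic t" using dyadic_add_iff[OF dyadic_divide_power2[of 1 2]] by simp
  moreover have "dyadic ((t + 1) / 2) \<longleftrightarrow> dyadic t"
  proof -
    have "2 * ((t + 1) / 2) = t + of_int 1" by simp
    then show ?thesis by (metis double dyadic_add_iff dyadic_of_int)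
  qed
  moreover have "x0 t \<in> {2 * t, t + 1 / 4, (t + 1) / 2}" by (simp add: x0_def min_def)
  ultimately show ?thesis using double[of t] by (metis insertE singletonD)
qed

lemma thompson_lift_x0_lift: "thompson_lift x0_lift"
  unfolding thompson_lift_def
proof (intro conjI)
  let ?B = "{of_int 0 / 2 ^ 0, of_int 1 / 2 ^ 2, of_int 1 / 2 ^ 1, of_int 1 / 2 ^ 0} :: real set"
  have "pow2_affine_at x0_lift x" if no_breakpoint: "x \<in> {0..1} - ?B" for x
  proof -
    consider "0 < x" "x < 1 / 4" | "1 / 4 < x" "x < 1 / 2" | "1 / 2 < x" "x < 1"
      using no_breakpoint by force
    then show ?thesis
    proof cases
      case 1
      then show ?thesis
        by (rule pow2_affine_atI[where k = 1 and c = 0]) (simp add: x0_lift_eq x0_def)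
    next
      case 2
      then show ?thesis
        by (rule pow2_affine_atI[where k = 0 and c = "1 / 4"]) (simp add: x0_lift_eq x0_def)
    next
      case 3
      then show ?thesis
        by (rule pow2_affine_atI[where k = "- 1" and c = "1 / 2"])
          (simp add: x0_lift_eq x0_def powr_minus min_def field_simps)
    qed
  qed
  moreover have "dyadic b" if "b \<in> ?B" for b using that dyadic_divide_power2 by blast
  ultimately show "\<exists>B. finite B \<and> (\<forall>b\<in>B. dyadic b) \<and> (\<forall>x\<in>{0..1} - B. \<exists>k::int. \<exists>e>0. \<forall>y.
      \<bar>y - x\<bar> < e \<longrightarrow> x0_lift y = x0_lift x + 2 powr real_of_int k * (y - x))"
    unfolding pow2_affine_at_def eventually_nhds_metric dist_real_def
    by (intro exI[of _ ?B]) blast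
  show "\<forall>x. dyadic x \<longleftrightarrow> dyadic (x0_lift x)"
    using dyadic_add_iff[OF dyadic_of_int]
    by (simp add: x0_lift_def equivariant_extension_def dyadic_x0_iff dyadic_frac_iff
        add.commute[of "real_of_int _"])
qed (use circle_lift_x0_lift in \<open>auto simp: circle_lift_def\<close>)

lemma (in circle_lift) funpow_tendsto_fixpoint:
  assumes "w \<le> b" "F b = b" "\<And>x. w \<le> x \<Longrightarrow> x < b \<Longrightarrow> x < F x"
  shows "(\<lambda>n. (F ^^ n) w) \<longlonglongrightarrow> b"
proof -
  have bounds: "w \<le> (F ^^ n) w \<and> (F ^^ n) w \<le> b" for n
  proof (induction n)
    case (Suc n)
    moreover have "F ((F ^^ n) w) \<le> b" using Suc le_iff[of "(F ^^ n) w" b] assms(2) by simp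
    moreover have "(F ^^ n) w \<le> F ((F ^^ n) w)" using Suc assms(2,3) by (metis order_le_less)
    ultimately show ?case by simp
  qed (use assms(1) in simp)
  have "incseq (\<lambda>n. (F ^^ n) w)"
    using bounds assms(2,3) by (intro incseq_SucI) (simp, metis order_le_less)
  then obtain l where limit: "(\<lambda>n. (F ^^ n) w) \<longlonglongrightarrow> l"
    using bounds incseq_convergent by blast
  then have "(\<lambda>n. F ((F ^^ n) w)) \<longlonglongrightarrow> F l"
    by (rule filterlim_compose[OF tendsto_nhds])
  moreover have "(\<lambda>n. F ((F ^^ n) w)) \<longlonglongrightarrow> l" using LIMSEQ_Suc[OF limit] by simp
  ultimately have "F l = l" by (rule LIMSEQ_unique)
  moreover have "w \<le> l" "l \<le> b" using bounds limit by (auto intro: LIMSEQ_le_const LIMSEQ_le_const2)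
  ultimately have "l = b" using assms(3)[of l] by force
  with limit show ?thesis by simp
qed

lemma thompson_lift_into_interval:
  assumes "u < v" "dyadic a" "a < b" "b < a + 1"
  obtains F where "thompson_circle_lift F" "F ` {b..<a + 1} \<subseteq> {u<..<v}"
proof -
  interpret x0: thompson_circle_lift x0_lift
    using thompson_lift_x0_lift by (simp only: thompson_lift_iff)
  obtain r where between: "dyadic r" "u < r" "r < v" using assms(1) by (rule dyadic_dense)
  have "x0_lift 1 = 1" by (simp add: x0_lift_def equivariant_extension_def x0_def)
  then have "(\<lambda>n. (x0_lift ^^ n) (b - a)) \<longlonglongrightarrow> 1"
    using assms(3,4) by (intro x0.funpow_tendsto_fixpoint) (auto simp: x0_lift_eq x0_def)
  then have "\<forall>\<^sub>F n in sequentially. 1 - (r - u) < (x0_lift ^^ n) (b - a)"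
    using between(2) by (intro order_tendstoD) auto
  then obtain n where near_1: "1 - (r - u) < (x0_lift ^^ n) (b - a)"
    using eventually_happens'[OF sequentially_bot] by blast
  define F where "F = (\<lambda>x. x + (r - of_int 1)) \<circ> (x0_lift ^^ n) \<circ> (\<lambda>x. x + - a)"
  have "(x0_lift ^^ n) 1 = 1" using \<open>x0_lift 1 = 1\<close> by (induction n) simp_all
  then have "u < F x \<and> F x < v" if "b \<le> x" "x < a + 1" for x
  proof -
    have "(x0_lift ^^ n) (b - a) \<le> (x0_lift ^^ n) (x - a)"
      "(x0_lift ^^ n) (x - a) < (x0_lift ^^ n) 1"
      using that by simp_all
    moreover have "F x = (x0_lift ^^ n) (x - a) + (r - 1)" by (simp add: F_def)
    ultimately show ?thesis using near_1 between(3) \<open>(x0_lift ^^ n) 1 = 1\<close> by linarith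
  qed
  then have "F ` {b..<a + 1} \<subseteq> {u<..<v}" by auto
  moreover have "thompson_circle_lift F"
    unfolding F_def using assms(2) between(1)
    by (intro thompson_circle_lift_comp thompson_circle_lift_translation
        x0.thompson_circle_lift_funpow dyadic_uminus dyadic_diff dyadic_of_int)
  ultimately show ?thesis using that by blast
qed

section \<open>Ping-pong\<close>

lemma (in group) int_pow_conj:
  assumes "g \<in> carrier G" "h \<in> carrier G"
  shows "(inv h \<otimes> g \<otimes> h) [^] (k::int) = inv h \<otimes> g [^] k \<otimes> h"
proof -
  have cancel: "h \<otimes> (inv h \<otimes> x) = x" if "x \<in> carrier G" for x
    using assms(2) that by (simp flip: m_assoc)
  interpret conj: group_hom G G "\<lambda>x. inv h \<otimes> x \<otimes> h"
    by (unfold_locales, rule homI) (use assms(2) in \<open>auto simp: m_assoc cancel\<close>)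
  show ?thesis using conj.hom_int_pow[OF assms(1), of k] by simp
qed

sublocale group_action \<subseteq> group G
  using group_hom by (rule group_hom.axioms(1))

context group_action
begin

lemma action_one: "x \<in> E \<Longrightarrow> \<phi> \<one> x = x"
  by (metis id_eq_one restrict_apply')

definition wandering :: "'a \<Rightarrow> 'c set \<Rightarrow> bool" where
  "wandering g U \<longleftrightarrow> (\<forall>k::int. \<forall>x\<in>U. \<phi> (g [^] k) x \<in> U \<longrightarrow> g [^] k = \<one>)"

lemma wandering_natI:
  assumes "g \<in> carrier G" "U \<subseteq> E"
    and nat: "\<And>(n::nat) x. x \<in> U \<Longrightarrow> \<phi> (g [^] n) x \<in> U \<Longrightarrow> g [^] n = \<one>"
  shows "wandering g U"
  unfolding wandering_def
proof (intro allI ballI impI)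
  fix k :: int and x assume x: "x \<in> U" "\<phi> (g [^] k) x \<in> U"
  show "g [^] k = \<one>"
  proof (cases k)
    case (nonneg n)
    then show ?thesis using nat[of x n] x by (simp add: int_pow_int)
  next
    case (neg n)
    then have power_neg: "g [^] k = inv (g [^] Suc n)"
      using assms(1) by (simp only: int_pow_neg_int)
    have "\<phi> (g [^] Suc n) (\<phi> (g [^] k) x) = x"
      using orbit_sym_aux[of "g [^] k" x] assms(1,2) x(1) by (auto simp: power_neg)
    then have "g [^] Suc n = \<one>" using nat x by metis
    then show ?thesis by (simp add: power_neg)
  qed
qed

lemma wandering_conj:
  assumes "wandering g U" "g \<in> carrier G" "h \<in> carrier G" "V \<subseteq> E" "\<phi> h ` V \<subseteq> U"
  shows "wandering (inv h \<otimes> g \<otimes> h) V"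
  unfolding wandering_def
proof (intro allI ballI impI)
  fix k :: int and x
  let ?c = "inv h \<otimes> g [^] k \<otimes> h"
  assume x: "x \<in> V" and "\<phi> ((inv h \<otimes> g \<otimes> h) [^] k) x \<in> V"
  then have "\<phi> h (\<phi> ?c x) \<in> U" using assms(2,3,5) by (auto simp: int_pow_conj)
  moreover have "h \<otimes> ?c = g [^] k \<otimes> h" using assms(2,3) by (simp flip: m_assoc)
  then have "\<phi> h (\<phi> ?c x) = \<phi> (g [^] k) (\<phi> h x)"
    using assms(2-4) x by (simp add: subset_iff flip: composition_rule)
  moreover have "\<phi> h x \<in> U" using assms(5) x by blast
  ultimately have "g [^] k = \<one>" using assms(1) by (metis wandering_def)
  then show "(inv h \<otimes> g \<otimes> h) [^] k = \<one>" using assms(2,3) by (simp add: int_pow_conj)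
qed

end

locale ping_pong = group_action G E \<phi> for G (structure) and E and \<phi> +
  fixes I :: "'i set" and c J p
  assumes generator_closed: "i \<in> I \<Longrightarrow> c i \<in> carrier G"
    and disjoint: "disjoint_family_on J I"
    and generator_wandering: "i \<in> I \<Longrightarrow> wandering (c i) (E - J i)"
    and base_in: "p \<in> E"
    and base_notin: "i \<in> I \<Longrightarrow> p \<notin> J i"
begin

inductive_set reachable where
  base: "p \<in> reachable"
| step: "x \<in> reachable \<Longrightarrow> i \<in> I \<Longrightarrow> x \<notin> J i \<Longrightarrow> \<phi> (c i [^] (k::int)) x \<in> reachable"

lemma reachable_in: "x \<in> reachable \<Longrightarrow> x \<in> E"
  by (induction rule: reachable.induct)
    (use base_in in \<open>auto intro: element_image[OF int_pow_closed] generator_closed\<close>)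

lemma generator_power_ping:
  fixes k :: int
  assumes "i \<in> I" "x \<in> E" "x \<notin> J i" "c i [^] k \<noteq> \<one>"
  shows "\<phi> (c i [^] k) x \<in> J i"
proof -
  have "\<phi> (c i [^] k) x \<in> E"
    using int_pow_closed[OF generator_closed[OF assms(1)]] assms(2) by (rule element_image) simp
  then show ?thesis
    using generator_wandering[OF assms(1)] assms(2-4) unfolding wandering_def by blast
qed

lemma reachable_cover: "x \<in> reachable \<Longrightarrow> x \<in> insert p (\<Union>i\<in>I. J i)"
proof (induction rule: reachable.induct)
  case (step x i k)
  note x = reachable_in[OF step.hyps(1)]
  show ?case
  proof (cases "c i [^] k = \<one>")
    case True
    then show ?thesis using step.IH x by (simp add: action_one)
  next
    case False
    then show ?thesis using generator_power_ping step.hyps x by blast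
  qed
qed simp

lemma reachable_closed:
  assumes "x \<in> reachable" "i \<in> I"
  shows "\<phi> (c i [^] (k::int)) x \<in> reachable"
  using assms(1)
proof (induction arbitrary: k rule: reachable.induct)
  case base
  show ?case using base_notin[OF assms(2)] assms(2) reachable.base by (intro reachable.step)
next
  case (step x j l)
  note x = reachable_in[OF step.hyps(1)]
  consider "c j [^] l = \<one>" | "i = j" | "i \<noteq> j" "c j [^] l \<noteq> \<one>" by blast
  then show ?case
  proof cases
    case 1
    then show ?thesis using step.IH x by (simp add: action_one)
  next
    case 2
    then have "\<phi> (c i [^] k) (\<phi> (c j [^] l) x) = \<phi> (c j [^] (k + l)) x"
      using x assms(2) by (simp add: int_pow_mult composition_rule generator_closed)
    then show ?thesis using reachable.step[OF step.hyps] by simp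
  next
    case 3
    have "\<phi> (c j [^] l) x \<in> J j" using generator_power_ping step.hyps x 3(2) by blast
    then have "\<phi> (c j [^] l) x \<notin> J i"
      using disjoint_family_onD[OF disjoint assms(2) step.hyps(2) 3(1)] by blast
    with reachable.step[OF step.hyps] assms(2) show ?thesis by (rule reachable.step)
  qed
qed

lemma generate_reachable:
  assumes "g \<in> generate G (c ` I)" "x \<in> reachable"
  shows "\<phi> g x \<in> reachable"
  using assms
proof (induction arbitrary: x rule: generate.induct)
  case one
  then show ?case using reachable_in by (simp add: action_one)
next
  case (incl h)
  then obtain i where "i \<in> I" "h = c i" by blast
  then show ?case using reachable_closed[OF incl(2), of i 1] by (simp add: generator_closed)
next
  case (inv h)
  then obtain i where "i \<in> I" "h = c i" by blast
  then show ?case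
    using reachable_closed[OF inv(2), of i "- 1"] by (simp add: generator_closed int_pow_neg)
next
  case (eng h1 h2)
  have "h1 \<in> carrier G" "h2 \<in> carrier G"
    using eng.hyps generate_in_carrier[of "c ` I"] generator_closed by blast+
  then show ?case using eng.IH eng.prems reachable_in by (simp add: composition_rule)
qed

theorem generate_base_orbit: "g \<in> generate G (c ` I) \<Longrightarrow> \<phi> g p \<in> insert p (\<Union>i\<in>I. J i)"
  by (intro reachable_cover generate_reachable reachable.base)

end

theorem (in group_action) not_invariably_generatedI:
  assumes disjoint: "disjoint_family_on J (carrier G)"
    and squeeze: "\<And>s. s \<in> carrier G \<Longrightarrow> \<exists>U. wandering s U \<and> (\<exists>h\<in>carrier G. \<phi> h ` (E - J s) \<subseteq> U)"
    and base: "p \<in> E" "\<And>s. s \<in> carrier G \<Longrightarrow> p \<notin> J s"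
    and moved: "g \<in> carrier G" "\<phi> g p \<noteq> p" "\<And>s. s \<in> carrier G \<Longrightarrow> \<phi> g p \<notin> J s"
  shows "\<not> invariably_generated G"
proof
  assume "invariably_generated G"
  then obtain S where S: "S \<subseteq> carrier G"
    and generates: "\<And>h. h \<in> S \<rightarrow> carrier G \<Longrightarrow> generate G ((\<lambda>s. inv (h s) \<otimes> s \<otimes> h s) ` S) = carrier G"
    unfolding invariably_generated_def by blast
  have "\<exists>h\<in>carrier G. wandering (inv h \<otimes> s \<otimes> h) (E - J s)" if s: "s \<in> carrier G" for s
  proof -
    obtain U h where "wandering s U" "h \<in> carrier G" "\<phi> h ` (E - J s) \<subseteq> U"
      using squeeze[OF s] by blast
    then show ?thesis using wandering_conj[OF _ s _ Diff_subset] by blast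
  qed
  then obtain h where conjugators: "\<And>s. s \<in> carrier G \<Longrightarrow> h s \<in> carrier G"
    "\<And>s. s \<in> carrier G \<Longrightarrow> wandering (inv (h s) \<otimes> s \<otimes> h s) (E - J s)" by metis
  interpret ping_pong G E \<phi> S "\<lambda>s. inv (h s) \<otimes> s \<otimes> h s" J p
    by unfold_locales (use S disjoint conjugators base in \<open>auto intro: disjoint_family_on_mono\<close>)
  have "g \<in> generate G ((\<lambda>s. inv (h s) \<otimes> s \<otimes> h s) ` S)"
    using generates[of h] conjugators(1) S moved(1) by auto
  then have "\<phi> g p \<in> insert p (\<Union>s\<in>S. J s)" by (rule generate_base_orbit)
  with moved(2,3) S show False by blast
qed

section \<open>Thompson's group \<open>T\<close>\<close>

lemma thompson_T_simps [simp]: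
  "carrier thompson_T = circle_map ` Collect thompson_circle_lift"
  "monoid.mult thompson_T = (\<circ>)" "\<one>\<^bsub>thompson_T\<^esub> = circle_map id"
  by (simp_all add: thompson_T_def thompson_T_set_eq circle_map_def)

lemma group_thompson_T: "group thompson_T"
proof (rule groupI)
  fix f g assume "f \<in> carrier thompson_T" "g \<in> carrier thompson_T"
  then obtain F G where "thompson_circle_lift F" "thompson_circle_lift G"
    "f = circle_map F" "g = circle_map G" by auto
  then show "f \<otimes>\<^bsub>thompson_T\<^esub> g \<in> carrier thompson_T"
    by (auto simp: circle_lift.circle_map_comp thompson_circle_lift.axioms(1)
        intro: thompson_circle_lift_comp)
next
  show "\<one>\<^bsub>thompson_T\<^esub> \<in> carrier thompson_T"
    using thompson_circle_lift_translation[OF dyadic_of_int, of 0] by (simp add: id_def)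
next
  fix f assume "f \<in> carrier thompson_T"
  then obtain F where F: "thompson_circle_lift F" "f = circle_map F" by auto
  interpret F: thompson_circle_lift F by fact
  show "\<one>\<^bsub>thompson_T\<^esub> \<otimes>\<^bsub>thompson_T\<^esub> f = f"
    by (auto simp: F(2) circle_map_def)
  obtain G where FG: "\<And>x. F (G x) = x" using F.surj by (metis surjD)
  interpret G: thompson_circle_lift G by (rule F.thompson_circle_lift_inverse[OF FG])
  have "G (F x) = x" for x using F.eq_iff[of "G (F x)" x] by (simp add: FG)
  then have "G \<circ> F = id" by auto
  then have "circle_map G \<otimes>\<^bsub>thompson_T\<^esub> f = \<one>\<^bsub>thompson_T\<^esub>"
    by (simp add: F(2) G.circle_map_comp)
  then show "\<exists>g\<in>carrier thompson_T. g \<otimes>\<^bsub>thompson_T\<^esub> f = \<one>\<^bsub>thompson_T\<^esub>"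
    using G.thompson_circle_lift_axioms by auto
qed (auto simp: comp_assoc)

lemma thompson_T_nat_pow:
  assumes "thompson_circle_lift F"
  shows "circle_map F [^]\<^bsub>thompson_T\<^esub> (n::nat) = circle_map (F ^^ n)"
proof -
  interpret thompson_circle_lift F by fact
  show ?thesis
  proof (induction n)
    case (Suc n)
    have "circle_map (F ^^ n) \<circ> circle_map F = circle_map (F ^^ Suc n)"
      unfolding funpow_Suc_right by (rule circle_lift.circle_map_comp[OF circle_lift_funpow])
    with Suc show ?case by (simp only: nat_pow_Suc thompson_T_simps)
  qed (simp add: id_def)
qed

lemma group_action_thompson_T: "group_action thompson_T {0..<1} (\<lambda>f. restrict f {0..<1})"
proof -
  interpret group thompson_T by (rule group_thompson_T)
  have in_range: "f x \<in> {0..<1}" if "f \<in> carrier thompson_T" for f x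
    using that by (auto simp: circle_map_def frac_lt_1)
  have Bij: "restrict f {0..<1} \<in> Bij {0..<1}" if f: "f \<in> carrier thompson_T" for f
  proof -
    let ?g = "inv\<^bsub>thompson_T\<^esub> f"
    have "f \<circ> ?g = frac" "?g \<circ> f = frac"
      using r_inv[OF f] l_inv[OF f] by (simp_all add: circle_map_def)
    then have "f (?g x) = x" "?g (f x) = x" if "x \<in> {0..<1}" for x
      using that by (metis comp_apply frac_eq_id)+
    then have "bij_betw f {0..<1} {0..<1}"
      using in_range f by (intro bij_betw_byWitness[of _ ?g]) blast+
    then show ?thesis by (simp add: Bij_def)
  qed
  show ?thesis
  proof (intro group_action.intro group_hom.intro group_hom_axioms.intro homI)
    fix f g assume fg: "f \<in> carrier thompson_T" "g \<in> carrier thompson_T"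
    have "restrict (f \<circ> g) {0..<1} = compose {0..<1} (restrict f {0..<1}) (restrict g {0..<1})"
      using in_range[OF fg(2)] by (auto simp: compose_def)
    then show "restrict (f \<otimes>\<^bsub>thompson_T\<^esub> g) {0..<1} =
        restrict f {0..<1} \<otimes>\<^bsub>BijGroup {0..<1}\<^esub> restrict g {0..<1}"
      using Bij fg by (simp add: BijGroup_def)
  next
    show "restrict f {0..<1} \<in> carrier (BijGroup {0..<1})" if "f \<in> carrier thompson_T" for f
      using Bij[OF that] by (simp add: BijGroup_def)
  qed (rule group_thompson_T group_BijGroup)+
qed

interpretation T: group_action thompson_T "{0..<1}" "\<lambda>f. restrict f {0..<1}"
  by (rule group_action_thompson_T)

lemma thompson_T_wandering_interval:
  assumes "s \<in> carrier thompson_T"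
  obtains u v where "u < v" "T.wandering s (frac ` {u<..<v})"
proof -
  obtain F where F: "thompson_circle_lift F" "s = circle_map F" using assms by auto
  interpret F: thompson_circle_lift F by fact
  obtain u v where "u < v" and wandering: "F.wandering {u<..<v}"
    using F.wandering_interval_exists[OF F.periodic_point_exists] by blast
  have "T.wandering s (frac ` {u<..<v})"
  proof (rule T.wandering_natI[OF assms])
    show arc: "frac ` {u<..<v} \<subseteq> {0..<1}" by (auto simp: frac_lt_1)
    fix n :: nat and x
    assume x: "x \<in> frac ` {u<..<v}"
      and y: "restrict (s [^]\<^bsub>thompson_T\<^esub> n) {0..<1} x \<in> frac ` {u<..<v}"
    have pow: "s [^]\<^bsub>thompson_T\<^esub> n = circle_map (F ^^ n)"
      unfolding F(2) by (rule thompson_T_nat_pow[OF F(1)])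
    obtain a where a: "a \<in> {u<..<v}" "x = frac a" using x by blast
    have "restrict (s [^]\<^bsub>thompson_T\<^esub> n) {0..<1} x = circle_map (F ^^ n) (frac a)"
      using x arc by (auto simp: pow a(2))
    also have "\<dots> = frac ((F ^^ n) a)"
      unfolding circle_lift.circle_map_frac[OF F.circle_lift_funpow] by (simp add: circle_map_def)
    finally obtain b where "b \<in> {u<..<v}" "(F ^^ n) a - b \<in> \<int>"
      using y by (auto simp: frac_eq_frac_iff)
    then have "(F ^^ n) z - z \<in> \<int>" for z
      using wandering a(1) unfolding F.wandering_def by blast
    then show "s [^]\<^bsub>thompson_T\<^esub> n = \<one>\<^bsub>thompson_T\<^esub>"
      by (auto simp: pow circle_map_def frac_eq_frac_iff)
  qed
  with \<open>u < v\<close> show ?thesis using that by blast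
qed

lemma thompson_T_squeeze:
  assumes "u < v" "dyadic a" "0 \<le> a" "a < b" "b < 1"
  obtains h where "h \<in> carrier thompson_T" "h ` ({0..<1} - {a..<b}) \<subseteq> frac ` {u<..<v}"
proof -
  have "b < a + 1" using assms by simp
  with assms(1,2,4) obtain F where F: "thompson_circle_lift F" "F ` {b..<a + 1} \<subseteq> {u<..<v}"
    by (rule thompson_lift_into_interval)
  interpret F: thompson_circle_lift F by fact
  have "circle_map F ` ({0..<1} - {a..<b}) \<subseteq> frac ` {u<..<v}"
  proof (rule image_subsetI)
    fix x assume "x \<in> {0..<1} - {a..<b}"
    then have "x \<in> {b..<a + 1} \<or> x + 1 \<in> {b..<a + 1}" using assms by auto
    then have "F x \<in> {u<..<v} \<or> F (x + 1) \<in> {u<..<v}" using F(2) by blast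
    moreover have "frac (F (x + 1)) = frac (F x)" by (simp add: F.add_1 frac_1_eq)
    ultimately show "circle_map F x \<in> frac ` {u<..<v}" unfolding circle_map_def by (metis imageI)
  qed
  moreover have "circle_map F \<in> carrier thompson_T" using F(1) by simp
  ultimately show ?thesis using that by blast
qed

lemma disjoint_family_Ico_decseq:
  fixes a :: "nat \<Rightarrow> 'a::linorder"
  assumes "decseq a"
  shows "disjoint_family (\<lambda>n. {a (Suc n)..<a n})"
proof -
  have "{a (Suc m)..<a m} \<inter> {a (Suc n)..<a n} = {}" if "m < n" for m n
    using decseqD[OF assms, of "Suc m" n] that by auto
  then show ?thesis unfolding disjoint_family_on_def by (metis Int_commute linorder_neqE_nat)
qed

definition dyadic_arc :: "nat \<Rightarrow> real set" where
  "dyadic_arc n = {1 / 2 ^ (n + 2)..<1 / 2 ^ (n + 1)}"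

lemma disjoint_dyadic_arcs:
  assumes "inj_on f A"
  shows "disjoint_family_on (\<lambda>s. dyadic_arc (f s)) A"
proof -
  have "decseq (\<lambda>n. 1 / (2::real) ^ (n + 1))" by (intro decseq_SucI) (simp add: field_simps)
  from disjoint_family_Ico_decseq[OF this] have "disjoint_family dyadic_arc"
    by (simp add: dyadic_arc_def[abs_def])
  then show ?thesis using assms by (auto simp: disjoint_family_on_def inj_on_def)
qed

lemma dyadic_arc_squeeze:
  assumes "u < v"
  obtains h where "h \<in> carrier thompson_T" "h ` ({0..<1} - dyadic_arc n) \<subseteq> frac ` {u<..<v}"
proof -
  have "dyadic (1 / 2 ^ (n + 2))"
    using dyadic_divide_power2[of 1 "n + 2"] by (simp only: of_int_1)
  moreover have "1 / 2 ^ (n + 2) < 1 / (2::real) ^ (n + 1)" by (simp add: field_simps)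
  moreover have "1 / (2::real) ^ (n + 1) < 1"
    using one_less_power[of "2::real" "n + 1"] by simp
  ultimately show ?thesis
    using thompson_T_squeeze[OF assms, of "1 / 2 ^ (n + 2)" "1 / 2 ^ (n + 1)"] that
    unfolding dyadic_arc_def by auto
qed

lemma dyadic_arc_subset: "dyadic_arc n \<subseteq> {0<..<1 / 2}"
proof
  fix x assume "x \<in> dyadic_arc n"
  then have "1 / 2 ^ (n + 2) \<le> x" "x < 1 / 2 ^ (n + 1)"
    by (simp_all only: dyadic_arc_def atLeastLessThan_iff)
  moreover have "0 < 1 / (2::real) ^ (n + 2)" "1 / (2::real) ^ (n + 1) \<le> 1 / 2"
    by (simp_all add: field_simps)
  ultimately show "x \<in> {0<..<1 / 2}" unfolding greaterThanLessThan_iff by linarith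
qed

lemma wandering_dyadic_arc_squeeze:
  assumes "s \<in> carrier thompson_T"
  shows "\<exists>U. T.wandering s U \<and>
    (\<exists>h\<in>carrier thompson_T. restrict h {0..<1} ` ({0..<1} - dyadic_arc n) \<subseteq> U)"
proof -
  obtain u v where "u < v" "T.wandering s (frac ` {u<..<v})"
    using assms by (rule thompson_T_wandering_interval)
  moreover from \<open>u < v\<close> obtain h where
    "h \<in> carrier thompson_T" "h ` ({0..<1} - dyadic_arc n) \<subseteq> frac ` {u<..<v}"
    by (rule dyadic_arc_squeeze)
  ultimately show ?thesis by (intro exI conjI bexI[of _ h]) auto
qed

theorem theorem4p6:
  shows "\<not> invariably_generated thompson_T"
proof (rule T.not_invariably_generatedI)
  let ?J = "\<lambda>s. dyadic_arc (to_nat_on thompson_T_set s)"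
  show "disjoint_family_on ?J (carrier thompson_T)"
    using inj_on_to_nat_on[OF countable_thompson_T_set]
    by (simp add: thompson_T_set_eq disjoint_dyadic_arcs)
  show "\<exists>U. T.wandering s U \<and> (\<exists>h\<in>carrier thompson_T. restrict h {0..<1} ` ({0..<1} - ?J s) \<subseteq> U)"
    if "s \<in> carrier thompson_T" for s
    using that by (rule wandering_dyadic_arc_squeeze)
  let ?r = "circle_map (\<lambda>x. x + 1 / 2)"
  show "?r \<in> carrier thompson_T"
    using thompson_circle_lift_translation[OF dyadic_divide_power2[of 1 1]] by simp
  have "restrict ?r {0..<1} 0 = 1 / 2" by (simp add: circle_map_def frac_eq)
  then show "restrict ?r {0..<1} 0 \<noteq> 0" "restrict ?r {0..<1} 0 \<notin> ?J s" "0 \<notin> ?J s" for s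
    using dyadic_arc_subset[of "to_nat_on thompson_T_set s"] by auto
qed simp

end
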